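(* Consider the scalar equation $\dot{x}(t)+\sum_{k=1}^m a_k(t)x(h_k(t))=0$. Suppose $a_k(t)\ge 0$ for $k=1,\dots,m$, $\sum_{k=1}^m a_k(t)\neq 0$ almost everywhere, $$\limsup_{t\to\infty}\sum_{k=1}^m \frac{a_k(t)}{\sum_{i=1}^m a_i(t)}\int_{h_k(t)}^t\sum_{i=1}^m a_i(s)\,ds<1+\frac1e,$$ $$\int_0^\infty\sum_{k=1}^m a_k(t)\,dt=\infty,\qquad \limsup_{t\to\infty}\int_{h_k(t)}^t\sum_{i=1}^m a_i(s)\,ds<\infty\quad (k=1,\dots,m).$$ Then the equation is asymptotically stable. If in addition there exists $R>0$ such that $\liminf_{t\to\infty}\int_t^{t+R}\sum_{k=1}^m a_k(\tau)\,d\tau>0$, then the fundamental function of the equation has an exponential estimation. If moreover also $\limsup_{t\to\infty}(t-h_k(t))<\infty$ for $k=1,\dots,m$, then the equation is exponentially stable.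
   Context: Standing assumptions: $a_k:[0,\infty)\to\mathbb{R}$ are Lebesgue measurable and essentially bounded; $h_k:[0,\infty)\to\mathbb{R}$ are Lebesgue measurable, $h_k(t)\le t$, $\lim_{t\to\infty}h_k(t)=\infty$ (so $h_k(t)\ge 0$ for large $t$ and the integrals in the limit conditions make sense). The quotient is considered at those $t$ where its denominator is nonzero (almost all $t$). For any $t_0\ge 0$, $x_0\in\mathbb{R}$ and any bounded Borel measurable $\varphi:(-\infty,t_0)\to\mathbb{R}$, the solution of the equation with initial conditions $x(t)=\varphi(t)$ for $t<t_0$, $x(t_0)=x_0$ is the function satisfying these conditions which is locally absolutely continuous on $[t_0,\infty)$ and satisfies the equation for almost all $t\ge t_0$. The fundamental function $X(t,s)$ is, for each $s\ge0$, the solution on $t\ge s$ with $X(t,s)=0$ for $t<s$ and $X(s,s)=1$. It has an exponential estimation if there are $K>0,\lambda>0$ with $|X(t,s)|\le Ke^{-\lambda(t-s)}$ for all $t\ge s\ge 0$. The equation is stable if for every $t_0\ge0$ and $\varepsilon>0$ there is $\delta>0$ such that $\sup_{t<t_0}|\varphi(t)|+|x(t_0)|<\delta$ implies $|x(t)|<\varepsilon$ for $t\ge t_0$. It is asymptotically stable if it is stable and, for every $t_0\ge0$, all solutions tend to zero as $t\to\infty$. It is exponentially stable if there are $M>0,\mu>0$, independent of $t_0$ and of the initial data, such that every solution satisfies $|x(t)|\le Me^{-\mu(t-t_0)}\left(|x(t_0)|+\sup_{t<t_0}|\varphi(t)|\right)$ for $t\ge t_0$. *)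

theory Defs
  imports "HOL-Analysis.Analysis"
begin

text \<open>Absolute continuity of a real function on a compact interval; the library's
  \<open>absolutely_continuous\<close> is a relation between measures.\<close>

definition abs_continuous_on_interval :: "real \<Rightarrow> real \<Rightarrow> (real \<Rightarrow> real) \<Rightarrow> bool" where
  "abs_continuous_on_interval c d f \<longleftrightarrow>
     (\<forall>\<epsilon>>0. \<exists>\<delta>>0. \<forall>(n::nat) u v.
        (\<forall>i<n. c \<le> u i \<and> u i \<le> v i \<and> v i \<le> d) \<and>
        (\<forall>i<n. \<forall>j<n. i \<noteq> j \<longrightarrow> {u i<..<v i} \<inter> {u j<..<v j} = {}) \<and>
        (\<Sum>i<n. v i - u i) < \<delta>
        \<longrightarrow> (\<Sum>i<n. \<bar>f (v i) - f (u i)\<bar>) < \<epsilon>)"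

definition locally_abs_continuous_from :: "real \<Rightarrow> (real \<Rightarrow> real) \<Rightarrow> bool" where
  "locally_abs_continuous_from t0 f \<longleftrightarrow> (\<forall>d>t0. abs_continuous_on_interval t0 d f)"

text \<open>The equation is \<open>x'(t) + (\<Sum>k=1..m. a k t * x (h k t)) = 0\<close>. Functions on \<open>[0,\<infinity>)\<close> or on
  \<open>(-\<infinity>,t0)\<close> are total functions on the reals of which only the values on that domain are
  used. A solution includes its history: it is a function on the whole line that coincides
  with \<open>\<phi>\<close> to the left of \<open>t0\<close>.\<close>

definition is_solution ::
  "nat \<Rightarrow> (nat \<Rightarrow> real \<Rightarrow> real) \<Rightarrow> (nat \<Rightarrow> real \<Rightarrow> real) \<Rightarrow> real \<Rightarrow> (real \<Rightarrow> real) \<Rightarrow> real \<Rightarrow> (real \<Rightarrow> real) \<Rightarrow> bool"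
where
  "is_solution m a h t0 \<phi> x0 x \<longleftrightarrow>
     (\<forall>t<t0. x t = \<phi> t) \<and> x t0 = x0 \<and>
     locally_abs_continuous_from t0 x \<and>
     (AE t in lebesgue. t \<ge> t0 \<longrightarrow>
        (\<exists>x'. (x has_real_derivative x') (at t) \<and> x' + (\<Sum>k=1..m. a k t * x (h k t)) = 0))"

definition initial_function :: "real \<Rightarrow> (real \<Rightarrow> real) \<Rightarrow> bool" where
  "initial_function t0 \<phi> \<longleftrightarrow>
     \<phi> \<in> borel_measurable (restrict_space borel {..<t0}) \<and> bounded (\<phi> ` {..<t0})"

definition fundamental_function ::
  "nat \<Rightarrow> (nat \<Rightarrow> real \<Rightarrow> real) \<Rightarrow> (nat \<Rightarrow> real \<Rightarrow> real) \<Rightarrow> real \<Rightarrow> real \<Rightarrow> real"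
where
  "fundamental_function m a h t s = (THE x. is_solution m a h s (\<lambda>_. 0) 1 x) t"

definition has_exponential_estimation :: "(real \<Rightarrow> real \<Rightarrow> real) \<Rightarrow> bool" where
  "has_exponential_estimation X \<longleftrightarrow>
     (\<exists>K>0. \<exists>lam>0. \<forall>s\<ge>0. \<forall>t\<ge>s. \<bar>X t s\<bar> \<le> K * exp (- lam * (t - s)))"

definition stable ::
  "nat \<Rightarrow> (nat \<Rightarrow> real \<Rightarrow> real) \<Rightarrow> (nat \<Rightarrow> real \<Rightarrow> real) \<Rightarrow> bool"
where
  "stable m a h \<longleftrightarrow>
     (\<forall>t0\<ge>0. \<forall>\<epsilon>>0. \<exists>\<delta>>0. \<forall>\<phi> x0 x.
        initial_function t0 \<phi> \<and> is_solution m a h t0 \<phi> x0 x \<and>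
        (SUP t\<in>{..<t0}. \<bar>\<phi> t\<bar>) + \<bar>x t0\<bar> < \<delta>
        \<longrightarrow> (\<forall>t\<ge>t0. \<bar>x t\<bar> < \<epsilon>))"

definition asymptotically_stable ::
  "nat \<Rightarrow> (nat \<Rightarrow> real \<Rightarrow> real) \<Rightarrow> (nat \<Rightarrow> real \<Rightarrow> real) \<Rightarrow> bool"
where
  "asymptotically_stable m a h \<longleftrightarrow>
     stable m a h \<and>
     (\<forall>t0\<ge>0. \<forall>\<phi> x0 x. initial_function t0 \<phi> \<and> is_solution m a h t0 \<phi> x0 x
        \<longrightarrow> (x \<longlongrightarrow> 0) at_top)"

definition exponentially_stable ::
  "nat \<Rightarrow> (nat \<Rightarrow> real \<Rightarrow> real) \<Rightarrow> (nat \<Rightarrow> real \<Rightarrow> real) \<Rightarrow> bool"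
where
  "exponentially_stable m a h \<longleftrightarrow>
     (\<exists>M>0. \<exists>\<mu>>0. \<forall>t0\<ge>0. \<forall>\<phi> x0 x.
        initial_function t0 \<phi> \<and> is_solution m a h t0 \<phi> x0 x
        \<longrightarrow> (\<forall>t\<ge>t0. \<bar>x t\<bar> \<le> M * exp (- \<mu> * (t - t0)) *
                               (\<bar>x t0\<bar> + (SUP t\<in>{..<t0}. \<bar>\<phi> t\<bar>))))"

end

theory Submission
  imports Defs
begin

text \<open>Let \<open>B(t)\<close> be the integral of \<open>b = \<Sum>k. a k\<close> over \<open>[0,t]\<close>; in the time \<open>B\<close> a solution bounded by \<open>A\<close> has
  slope at most \<open>A\<close>, and the weighted mean of the delays is at most some \<open>T < 1 + 1/e\<close>. If \<open>\<bar>x\<bar> \<le> A\<close> and \<open>x\<close>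
  vanishes at some point, then the rise of \<open>x\<close> afterwards is controlled by comparison with the extremal
  curve that first has slope \<open>A\<close> and then follows the equation with all delays equal either to zero or to
  the smallest delay for which the history can be \<open>- A\<close>. This curve stays below
  \<open>0.999 * A\<close>, so each zero contracts the amplitude. If there is no zero, then \<open>\<bar>x\<bar>\<close> decreases and satisfies
  \<open>\<bar>x\<bar>' \<le> - b * \<bar>x\<bar>\<close>. As all delays are bounded in the time \<open>B\<close>, this gives a bound
  \<open>\<bar>x(t)\<bar> \<le> K * exp (- \<mu> * (B(t) - B(t0)))\<close> times the size of the initial data, uniformly in \<open>t0\<close>. All three
  claims follow, since \<open>B\<close> tends to infinity, and grows at least linearly under the additional
  assumption.\<close>

text \<open>Normalise \<open>A = 1\<close>, put \<open>z = 1 + x\<close> and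
  \<open>U = B(t) - B(s0) + 1\<close> for a zero \<open>s0\<close>. Then \<open>z = U\<close> is the
  steepest approach to the zero, and an overshoot to the old amplitude means \<open>z = 2\<close>.
  The obstacle is that only the weighted mean of the delays is small; a single delay
  \<open>d\<close> may be much longer. What is needed is a lower bound of the past values that is
  affine in \<open>d\<close>, since its mean depends on the mean delay alone. The chord
  \<open>z * (1 - d / U)\<close> is such a bound. With mean delay \<open>T\<close> it yields the
  slope \<open>1 - z + z * T / U\<close>, attained by weight \<open>T / U\<close> on the delay
  \<open>U\<close> and the rest on the delay \<open>0\<close>. The past lies above the chord if the
  comparison curve is star-shaped about the origin and the lag of the solution behind the curve, the
  difference of \<open>B\<close> and \<open>U(z)\<close>, is at its running maximum. That is enough:
  a loss of lag would have to start at a maximum. Near a maximum the past is known up to a tolerance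
  \<open>\<eta>\<close>, which the gap between \<open>T'\<close> and \<open>13679/10000\<close> pays
  for. Replacing the curve by a polygon with rational vertices leaves finitely many arithmetic
  checks.\<close>

section \<open>Absolutely continuous functions and differentiation almost everywhere\<close>

text \<open>A gauge argument: tags outside the null set \<open>N\<close> use the local estimate,
  while cells tagged in \<open>N\<close> have small total length, so absolute continuity bounds
  their total increment. A straddling one-sided estimate replaces the derivative because the lemma
  is applied to a maximum of lines along a solution, which has kinks.\<close>

lemma abs_continuous_mono_dini:
  fixes f :: "real \<Rightarrow> real"
  assumes ac: "abs_continuous_on_interval c d f" and cd: "c \<le> d"
    and dini: "AE t in lebesgue. c \<le> t \<and> t \<le> d \<longrightarrow>
      (\<forall>\<epsilon>>0. \<exists>\<delta>>0. \<forall>u v. c \<le> u \<and> u \<le> t \<and> t \<le> v \<and> v \<le> d \<and> v - u < \<delta> \<longrightarrow>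
        - \<epsilon> * (v - u) \<le> f v - f u)"
  shows "f c \<le> f d"
proof (rule field_le_epsilon)
  fix e :: real assume "e > 0"
  \<comment> \<open>The cells with good tags lose at most \<open>\<epsilon> * (d - c)\<close> and
    the others at most \<open>\<epsilon>\<close>, together \<open>e\<close>.\<close>
  define \<epsilon> where "\<epsilon> = e / (1 + (d - c))"
  have \<epsilon>: "\<epsilon> > 0" using \<open>e > 0\<close> cd by (simp add: \<epsilon>_def)
  let ?good = "\<lambda>t. c \<le> t \<and> t \<le> d \<longrightarrow>
      (\<forall>\<epsilon>>0. \<exists>\<delta>>0. \<forall>u v. c \<le> u \<and> u \<le> t \<and> t \<le> v \<and> v \<le> d \<and> v - u < \<delta> \<longrightarrow>
        - \<epsilon> * (v - u) \<le> f v - f u)"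
  define N where "N = {t. \<not> ?good t}"
  have negN: "negligible N"
    using dini unfolding N_def eventually_ae_filter_negligible
    by (auto intro: negligible_subset)
  obtain \<eta> where \<eta>: "\<eta> > 0" and ac\<eta>: "\<And>(n::nat) u v.
        (\<forall>i<n. c \<le> u i \<and> u i \<le> v i \<and> v i \<le> d) \<Longrightarrow>
        (\<forall>i<n. \<forall>j<n. i \<noteq> j \<longrightarrow> {u i<..<v i} \<inter> {u j<..<v j} = {}) \<Longrightarrow>
        (\<Sum>i<n. v i - u i) < \<eta>
        \<Longrightarrow> (\<Sum>i<n. \<bar>f (v i) - f (u i)\<bar>) < \<epsilon>"
  proof -
    obtain \<eta> where "\<eta> > 0" and *: "\<forall>(n::nat) u v.
        (\<forall>i<n. c \<le> u i \<and> u i \<le> v i \<and> v i \<le> d) \<and>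
        (\<forall>i<n. \<forall>j<n. i \<noteq> j \<longrightarrow> {u i<..<v i} \<inter> {u j<..<v j} = {}) \<and>
        (\<Sum>i<n. v i - u i) < \<eta>
        \<longrightarrow> (\<Sum>i<n. \<bar>f (v i) - f (u i)\<bar>) < \<epsilon>"
      using ac \<epsilon> unfolding abs_continuous_on_interval_def by blast
    show thesis by (rule that[OF \<open>\<eta> > 0\<close>]) (use * in blast)
  qed
  obtain O' where O': "open O'" "N \<subseteq> O'" "O' \<in> lmeasurable" "measure lebesgue O' < \<eta>"
  proof -
    have "N \<in> lmeasurable" "measure lebesgue N = 0"
      using negN by (auto simp: negligible_iff_measure)
    from sets_lebesgue_outer_open[OF fmeasurableD[OF this(1)] \<eta>] obtain T where
      "open T" "N \<subseteq> T" "T - N \<in> lmeasurable" "emeasure lebesgue (T - N) < ennreal \<eta>" .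
    have "T = N \<union> (T - N)" using \<open>N \<subseteq> T\<close> by blast
    then have "T \<in> lmeasurable"
      using fmeasurable.Un[OF \<open>N \<in> lmeasurable\<close> \<open>T - N \<in> lmeasurable\<close>] by simp
    moreover have "measure lebesgue (T - N) < \<eta>"
      using \<open>emeasure lebesgue (T - N) < ennreal \<eta>\<close> \<open>T - N \<in> lmeasurable\<close> \<eta>
      by (simp add: emeasure_eq_measure2 ennreal_less_iff)
    moreover have "measure lebesgue T \<le> measure lebesgue N + measure lebesgue (T - N)"
      using measure_Un_le[of N lebesgue "T - N"] \<open>N \<in> lmeasurable\<close> \<open>T - N \<in> lmeasurable\<close>
        \<open>T = N \<union> (T - N)\<close> by (simp add: fmeasurableD)
    ultimately show ?thesis
      using that \<open>open T\<close> \<open>N \<subseteq> T\<close> \<open>measure lebesgue N = 0\<close> by simp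
  qed
  have "\<exists>\<delta>>0. \<forall>u v. c \<le> u \<and> u \<le> t \<and> t \<le> v \<and> v \<le> d \<and> v - u < \<delta> \<longrightarrow>
        - \<epsilon> * (v - u) \<le> f v - f u" if "t \<notin> N" for t
  proof (cases "c \<le> t \<and> t \<le> d")
    case True then show ?thesis using that \<epsilon> unfolding N_def by blast
  next
    case False then show ?thesis by (intro exI[of _ 1]) auto
  qed
  then obtain \<delta> where \<delta>: "\<And>t. t \<notin> N \<Longrightarrow> \<delta> t > 0"
    "\<And>t u v. t \<notin> N \<Longrightarrow> c \<le> u \<Longrightarrow> u \<le> t \<Longrightarrow> t \<le> v \<Longrightarrow> v \<le> d \<Longrightarrow> v - u < \<delta> t \<Longrightarrow>
        - \<epsilon> * (v - u) \<le> f v - f u" by metis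
  \<comment> \<open>A fine cell tagged in \<open>N\<close> lies in \<open>O'\<close>; these cells do
    not overlap, so their total length is below \<open>\<eta>\<close>.\<close>
  define \<gamma> where "\<gamma> t = (if t \<in> N then O' else ball t (\<delta> t / 2))" for t
  have "gauge \<gamma>" using O' \<delta> by (auto simp: gauge_def \<gamma>_def)
  then obtain p where p: "p tagged_division_of {c..d}" and fine: "\<gamma> fine p"
    using fine_division_exists_real by blast
  have finp: "finite p" using p by blast
  have pK: "\<exists>u v. K = {u..v} \<and> u \<le> x \<and> x \<le> v \<and> c \<le> u \<and> v \<le> d \<and> Inf K = u \<and> Sup K = v" if "(x, K) \<in> p" for x K
  proof -
    have "\<exists>a b. K = cbox a b" using tagged_division_ofD(4)[OF p] \<open>(x, K) \<in> p\<close> by blast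
    then obtain u v where "K = cbox u v" by blast
    moreover have "x \<in> K" "K \<subseteq> {c..d}" using tagged_division_ofD(2,3)[OF p that] by auto
    ultimately show ?thesis by (intro exI[of _ u] exI[of _ v]) auto
  qed
  define F where "F = (\<lambda>(x::real, K::real set). f (Sup K) - f (Inf K))"
  define L where "L = (\<lambda>(x::real, K::real set). Sup K - Inf K)"
  have sumF: "(\<Sum>P\<in>p. F P) = f d - f c"
    using additive_tagged_division_1[OF cd p, of f] by (simp add: F_def)
  have sumL: "(\<Sum>P\<in>p. L P) = d - c"
    using additive_tagged_division_1[OF cd p, of "\<lambda>x. x"] by (simp add: L_def)
  have L0: "L P \<ge> 0" if "P \<in> p" for P using pK that by (cases P) (fastforce simp: L_def)
  define q where "q = {P\<in>p. fst P \<in> N}"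
  have finq: "finite q" "q \<subseteq> p" using finp by (auto simp: q_def)
  have reg: "(\<Sum>P\<in>p - q. F P) \<ge> (\<Sum>P\<in>p - q. - \<epsilon> * L P)"
  proof (rule sum_mono)
    fix P assume P: "P \<in> p - q"
    obtain x K where [simp]: "P = (x, K)" by (cases P)
    obtain u v where uv: "K = {u..v}" "u \<le> x" "x \<le> v" "c \<le> u" "v \<le> d" "Inf K = u" "Sup K = v"
      using pK[of x K] P by auto
    have xN: "x \<notin> N" using P by (auto simp: q_def)
    have "(x, K) \<in> p" using P by simp
    then have "K \<subseteq> \<gamma> x" using fine unfolding fine_def by blast
    then have "K \<subseteq> ball x (\<delta> x / 2)" using xN by (simp add: \<gamma>_def)
    moreover have "u \<in> K" "v \<in> K" using uv by auto
    ultimately have "u \<in> ball x (\<delta> x / 2)" "v \<in> ball x (\<delta> x / 2)" by blast+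
    then have "v - u < \<delta> x" by (auto simp: dist_real_def abs_if split: if_splits)
    then show "- \<epsilon> * L P \<le> F P" using \<delta>(2)[OF xN] uv by (simp add: F_def L_def)
  qed
  have "(\<Sum>P\<in>q. \<bar>F P\<bar>) < \<epsilon>"
  proof -
    obtain g where g: "bij_betw g {..<card q} q"
      using ex_bij_betw_nat_finite[OF finq(1)] by (auto simp: atLeast0LessThan)
    let ?u = "\<lambda>i. Inf (snd (g i))" and ?v = "\<lambda>i. Sup (snd (g i))"
    have gq: "g i \<in> q" if "i < card q" for i using g that by (auto simp: bij_betw_def)
    have gK: "c \<le> ?u i \<and> ?u i \<le> ?v i \<and> ?v i \<le> d \<and> snd (g i) = {?u i..?v i}" if "i < card q" for i
      using pK[of "fst (g i)" "snd (g i)"] gq[OF that] finq(2) by force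
    have disj: "{?u i<..<?v i} \<inter> {?u j<..<?v j} = {}" if "i < card q" "j < card q" "i \<noteq> j" for i j
    proof -
      have "g i \<noteq> g j" using g that by (auto simp: bij_betw_def inj_on_def)
      then have "interior (snd (g i)) \<inter> interior (snd (g j)) = {}"
        using tagged_division_ofD(5)[OF p, of "fst (g i)" "snd (g i)" "fst (g j)" "snd (g j)"]
          gq that finq(2) by (auto simp: prod_eq_iff)
      moreover have "interior (snd (g k)) = {?u k<..<?v k}" if "k < card q" for k
        using gK[OF that] interior_atLeastAtMost_real by metis
      ultimately show ?thesis using that by simp
    qed
    have "(\<Sum>i<card q. ?v i - ?u i) = (\<Sum>i<card q. measure lebesgue {?u i<..<?v i})"
      using gK by (intro sum.cong) auto
    also have "\<dots> = measure lebesgue (\<Union>i<card q. {?u i<..<?v i})"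
    proof (rule measure_finite_Union[symmetric])
      show "disjoint_family_on (\<lambda>i. {?u i<..<?v i}) {..<card q}"
        using disj unfolding disjoint_family_on_def by blast
      show "emeasure lebesgue {?u i<..<?v i} \<noteq> \<infinity>" if "i \<in> {..<card q}" for i
        using gK[of i] that by simp
    qed auto
    also have "\<dots> \<le> measure lebesgue O'"
    proof (rule measure_mono_fmeasurable)
      show "(\<Union>i<card q. {?u i<..<?v i}) \<subseteq> O'"
      proof clarify
        fix y i assume i: "i < card q" "y \<in> {?u i<..<?v i}"
        have "g i \<in> p" "fst (g i) \<in> N" using gq[OF i(1)] by (auto simp: q_def)
        then have "snd (g i) \<subseteq> \<gamma> (fst (g i))" using fine unfolding fine_def by (cases "g i") auto
        then have "snd (g i) \<subseteq> O'" using \<open>fst (g i) \<in> N\<close> by (simp add: \<gamma>_def)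
        moreover have "y \<in> snd (g i)" using gK[OF i(1)] i(2)
          by (metis atLeastAtMost_iff greaterThanLessThan_iff less_imp_le)
        ultimately show "y \<in> O'" by blast
      qed
    qed (use O' in auto)
    also have "\<dots> < \<eta>" by fact
    finally have "(\<Sum>i<card q. \<bar>f (?v i) - f (?u i)\<bar>) < \<epsilon>"
      using gK disj by (intro ac\<eta>) auto
    also have "(\<Sum>i<card q. \<bar>f (?v i) - f (?u i)\<bar>) = (\<Sum>P\<in>q. \<bar>F P\<bar>)"
      using sum.reindex_bij_betw[OF g, of "\<lambda>P. \<bar>F P\<bar>"] by (simp add: F_def split_def)
    finally show ?thesis .
  qed
  moreover have "\<bar>\<Sum>P\<in>q. F P\<bar> \<le> (\<Sum>P\<in>q. \<bar>F P\<bar>)" by (rule sum_abs)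
  moreover have "(\<Sum>P\<in>p. F P) = (\<Sum>P\<in>p - q. F P) + (\<Sum>P\<in>q. F P)"
    using sum.subset_diff[OF finq(2) finp] by blast
  moreover have "(\<Sum>P\<in>p - q. L P) \<le> (\<Sum>P\<in>p. L P)"
    using finp L0 by (intro sum_mono2) auto
  then have "\<epsilon> * (\<Sum>P\<in>p - q. L P) \<le> \<epsilon> * (d - c)" using \<epsilon> sumL by simp
  then have "(\<Sum>P\<in>p - q. - \<epsilon> * L P) \<ge> - \<epsilon> * (d - c)"
    by (simp add: sum_distrib_left[symmetric] sum_negf)
  ultimately have "f d - f c \<ge> - \<epsilon> * (d - c) - \<epsilon>" using reg sumF by linarith
  also have "- \<epsilon> * (d - c) - \<epsilon> = - (\<epsilon> * (1 + (d - c)))" by (simp add: algebra_simps)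
  also have "\<dots> = - e" using cd by (simp add: \<epsilon>_def)
  finally show "f c \<le> f d + e" by simp
qed

text \<open>Lebesgue differentiation by way of Henstock's lemma. On \<open>E k\<close> the
  difference quotients miss \<open>f t\<close> by \<open>1 / (k + 1)\<close> at arbitrarily small
  scales, and the offending intervals form a Vitali cover. Any finite disjoint selection is a fine
  partial division, so its summed errors, and with them its total length, are small.\<close>

lemma AE_indefinite_integral_derivative:
  fixes f :: "real \<Rightarrow> real"
  assumes f: "f integrable_on {c..d}"
  shows "AE t in lebesgue. c < t \<and> t < d \<longrightarrow>
    ((\<lambda>u. integral {c..u} f) has_real_derivative f t) (at t)"
proof -
  define F where "F u = integral {c..u} f" for u
  have Fdiff: "F v - F u = integral {u..v} f" if "c \<le> u" "u \<le> v" "v \<le> d" for u v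
  proof -
    have "f integrable_on {c..v}" using f by (rule integrable_subinterval_real) (use that in auto)
    from Henstock_Kurzweil_Integration.integral_combine[OF that(1,2) this] show ?thesis by (simp add: F_def)
  qed
  define bad where "bad k t w \<longleftrightarrow> c < t \<and> t < d \<and> c < w \<and> w < d \<and> w \<noteq> t \<and>
      \<bar>w - t\<bar> / real (Suc k) \<le> \<bar>F w - F t - f t * (w - t)\<bar>" for k t w
  define E where "E k = {t. \<forall>\<delta>>0. \<exists>w. bad k t w \<and> \<bar>w - t\<bar> < \<delta>}" for k
  have "negligible (E k)" for k
    unfolding negligible_outer_le
  proof (intro allI impI)
    fix e :: real assume "e > 0"
    \<comment> \<open>A bad interval has an error of at least its length divided by
      \<open>k + 1\<close>, so an error sum below \<open>\<epsilon>\<close> forces a total length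
      below \<open>e\<close>.\<close>
    define \<epsilon> where "\<epsilon> = e / real (Suc k)"
    have "\<epsilon> > 0" using \<open>e > 0\<close> by (simp add: \<epsilon>_def)
    obtain \<gamma> where \<gamma>: "gauge \<gamma>" "\<And>p. p tagged_partial_division_of (cbox c d) \<Longrightarrow> \<gamma> fine p \<Longrightarrow>
             sum (\<lambda>(x,k). norm (measure lborel k *\<^sub>R f x - integral k f)) p < \<epsilon>"
      using Henstock_lemma[of f c d \<epsilon>] f \<open>\<epsilon> > 0\<close> unfolding box_real(2) by blast
    define I where "I = (\<lambda>(t::real, w). {min t w..max t w})"
    define K where "K = {(t, w). t \<in> E k \<and> bad k t w \<and> I (t, w) \<subseteq> \<gamma> t}"
    \<comment> \<open>The covering theorem speaks of balls: the centre is the midpoint, while the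
      tag \<open>t\<close> remains an end point of the interval.\<close>
    let ?a = "\<lambda>(t::real, w). (t + w) / 2" and ?r = "\<lambda>(t::real, w). \<bar>t - w\<bar> / 2"
    have Iball: "cball (?a i) (?r i) = I i" for i
      by (cases i) (auto simp: I_def dist_real_def min_def max_def field_simps)
    have 1: "0 < ?r i" if "i \<in> K" for i using that by (auto simp: K_def bad_def)
    have 2: "\<exists>i. i \<in> K \<and> t \<in> cball (?a i) (?r i) \<and> ?r i < \<delta>" if t: "t \<in> E k" "0 < \<delta>" for t \<delta>
    proof -
      obtain \<rho> where \<rho>: "\<rho> > 0" "cball t \<rho> \<subseteq> \<gamma> t"
        using \<gamma>(1) by (meson gauge_def open_contains_cball)
      obtain w where w: "bad k t w" "\<bar>w - t\<bar> < min \<rho> \<delta>"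
        proof -
          have "min \<rho> \<delta> > 0" using t \<rho> by simp
          then show ?thesis using t(1) that unfolding E_def by blast
        qed
      have "I (t, w) \<subseteq> cball t \<rho>" using w(2) by (auto simp: I_def dist_real_def min_def max_def split: if_splits)
      then have "(t, w) \<in> K" using w t \<rho> by (auto simp: K_def)
      moreover have "t \<in> I (t, w)" by (auto simp: I_def)
      moreover have "?r (t, w) < \<delta>" using w(2) t(2) by auto
      ultimately show ?thesis using Iball by blast
    qed
    obtain C where C: "countable C" "C \<subseteq> K"
       "pairwise (\<lambda>i j. disjnt (cball (?a i) (?r i)) (cball (?a j) (?r j))) C"
       "negligible (E k - (\<Union>i \<in> C. cball (?a i) (?r i)))"
      using Vitali_covering_theorem_cballs[of K ?r "E k" ?a] 1 2 by blast
    have disj: "pairwise (\<lambda>i j. disjnt (I i) (I j)) C" and neg: "negligible (E k - (\<Union>i\<in>C. I i))"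
      using C(3,4) unfolding Iball by auto
    have finsum: "measure lebesgue (\<Union>i\<in>S. I i) \<le> e" if S: "finite S" "S \<subseteq> C" for S
    proof -
      define p where "p = (\<lambda>i. (fst i, I i)) ` S"
      have injp: "inj_on (\<lambda>i. (fst i, I i)) S"
      proof (rule inj_onI)
        fix i j assume ij: "i \<in> S" "j \<in> S" "(fst i, I i) = (fst j, I j)"
        have "fst i \<in> I i" by (cases i) (auto simp: I_def)
        then have "\<not> disjnt (I i) (I j)" using ij(3) by (auto simp: disjnt_def)
        moreover have "i \<in> C" "j \<in> C" using S ij by auto
        ultimately show "i = j" using disj unfolding pairwise_def by blast
      qed
      have SK: "i \<in> K" if "i \<in> S" for i using that S C by auto
      have Kp: "t \<in> I (t, w) \<and> I (t, w) \<subseteq> {c..d}" if "(t, w) \<in> K" for t w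
        using that by (auto simp: K_def bad_def I_def)
      have pE: "\<exists>w. (x, w) \<in> S \<and> L = I (x, w)" if "(x, L) \<in> p" for x L
        using that by (auto simp: p_def)
      have "p tagged_partial_division_of cbox c d"
        unfolding tagged_partial_division_of_def
      proof (intro conjI allI impI)
        show "finite p" using S by (simp add: p_def)
        fix x L assume xL: "(x, L) \<in> p"
        then obtain w where w: "(x, w) \<in> S" "L = I (x, w)" using pE by blast
        show "x \<in> L" "L \<subseteq> cbox c d" using Kp[OF SK[OF w(1)]] w by auto
        show "\<exists>u v. L = cbox u v" by (auto simp: w I_def)
      next
        fix x L x' L' assume xL': "(x, L) \<in> p \<and> (x', L') \<in> p \<and> (x, L) \<noteq> (x', L')"
        then obtain w where w: "(x, w) \<in> S" "L = I (x, w)" using pE by blast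
        from xL' obtain w' where w': "(x', w') \<in> S" "L' = I (x', w')" using pE by blast
        have "(x, w) \<noteq> (x', w')" using xL' w w' by auto
        then have "disjnt L L'" using disj S w w' unfolding pairwise_def by blast
        then show "interior L \<inter> interior L' = {}"
          using interior_subset[of L] interior_subset[of L'] unfolding disjnt_def by blast
      qed
      moreover have "\<gamma> fine p" using SK by (fastforce simp: fine_def p_def K_def)
      ultimately have less: "sum (\<lambda>(x,k). norm (measure lborel k *\<^sub>R f x - integral k f)) p < \<epsilon>" using \<gamma>(2) by blast
      have "measure lebesgue (I i) / real (Suc k) \<le> norm (measure lborel (I i) *\<^sub>R f (fst i) - integral (I i) f)" if i: "i \<in> S" for i
      proof -
        obtain t w where [simp]: "i = (t, w)" by (cases i)
        have b: "bad k t w" using SK[OF i] by (simp add: K_def)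
        then have cd: "c < t" "t < d" "c < w" "w < d" "\<bar>w - t\<bar> / real (Suc k) \<le> \<bar>F w - F t - f t * (w - t)\<bar>"
          by (auto simp: bad_def)
        show ?thesis
        proof (cases "t \<le> w")
          case True
          then show ?thesis using cd Fdiff[of t w] by (simp add: I_def abs_minus_commute mult.commute)
        next
          case False
          then have "integral {w..t} f = F t - F w" using cd Fdiff[of w t] by simp
          with False cd show ?thesis by (simp add: I_def abs_minus_commute algebra_simps abs_if split: if_splits)
        qed
      qed
      then have "(\<Sum>i\<in>S. measure lebesgue (I i) / real (Suc k)) \<le>
          (\<Sum>i\<in>S. norm (measure lborel (I i) *\<^sub>R f (fst i) - integral (I i) f))" by (rule sum_mono)
      also have "\<dots> = sum (\<lambda>(x,k). norm (measure lborel k *\<^sub>R f x - integral k f)) p"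
        unfolding p_def by (simp add: sum.reindex[OF injp])
      finally have "(\<Sum>i\<in>S. measure lebesgue (I i)) / real (Suc k) < \<epsilon>"
        using less by (simp add: sum_divide_distrib)
      then have "(\<Sum>i\<in>S. measure lebesgue (I i)) < e"
        unfolding \<epsilon>_def by (simp add: divide_less_cancel)
      moreover have "measure lebesgue (\<Union>i\<in>S. I i) \<le> (\<Sum>i\<in>S. measure lebesgue (I i))"
        using S by (intro measure_UNION_le) (auto simp: I_def)
      ultimately show ?thesis by simp
    qed
    have Im: "D \<in> lmeasurable" if "D \<in> I ` C" for D
      using that by (auto simp: I_def)
    have bound: "measure lebesgue (\<Union>\<D>) \<le> e" if "\<D> \<subseteq> I ` C" "finite \<D>" for \<D>
    proof -
      obtain S where "S \<subseteq> C" "finite S" "\<D> = I ` S"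
        using finite_subset_image[OF \<open>finite \<D>\<close> \<open>\<D> \<subseteq> I ` C\<close>] by blast
      then show ?thesis using finsum[of S] by simp
    qed
    have "countable (I ` C)" using C by simp
    define U where "U = \<Union>(I ` C)"
    have U: "U \<in> lmeasurable" "measure lebesgue U \<le> e"
      unfolding U_def using fmeasurable_Union_bound[of "I ` C" lebesgue e]
        measure_Union_bound[of "I ` C" lebesgue e] \<open>countable (I ` C)\<close> Im bound by blast+
    have R: "E k - U \<in> lmeasurable" "measure lebesgue (E k - U) = 0"
      using neg by (auto simp: negligible_iff_measure U_def)
    have "measure lebesgue ((E k - U) \<union> U) \<le> e"
      using measure_Un_le[of "E k - U" lebesgue U] U R by (simp add: fmeasurableD)
    moreover have "(E k - U) \<union> U \<in> lmeasurable" using U R by (intro fmeasurable.Un)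
    ultimately show "\<exists>T. E k \<subseteq> T \<and> T \<in> lmeasurable \<and> measure lebesgue T \<le> e"
      by (intro exI[of _ "(E k - U) \<union> U"]) auto
  qed
  then have "negligible (\<Union>k. E k)" by (intro negligible_countable_Union) auto
  then have "AE t in lebesgue. t \<notin> (\<Union>k. E k)"
    unfolding eventually_ae_filter_negligible by blast
  then show ?thesis
  proof (eventually_elim, intro impI)
    fix t assume t: "t \<notin> (\<Union>k. E k)" "c < t \<and> t < d"
    show "((\<lambda>u. integral {c..u} f) has_real_derivative f t) (at t)"
      unfolding F_def[symmetric] has_field_derivative_def has_derivative_at_alt
    proof (intro conjI allI impI)
      show "bounded_linear ((*) (f t))" by (rule bounded_linear_mult_right)
      fix e :: real assume "0 < e"
      then obtain k where k: "inverse (real (Suc k)) < e" using reals_Archimedean by blast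
      from t have "\<exists>\<delta>>0. \<forall>w. bad k t w \<longrightarrow> \<not> \<bar>w - t\<bar> < \<delta>" unfolding E_def by auto
      then obtain \<delta> where \<delta>: "\<delta> > 0" "\<And>w. \<bar>w - t\<bar> < \<delta> \<Longrightarrow> \<not> bad k t w" by blast
      show "\<exists>\<delta>>0. \<forall>y. norm (y - t) < \<delta> \<longrightarrow> norm (F y - F t - f t * (y - t)) \<le> e * norm (y - t)"
      proof (intro exI[of _ "min \<delta> (min (t - c) (d - t))"] conjI allI impI)
        fix y assume y: "norm (y - t) < min \<delta> (min (t - c) (d - t))"
        show "norm (F y - F t - f t * (y - t)) \<le> e * norm (y - t)"
        proof (cases "y = t")
          case False
          then have "\<bar>F y - F t - f t * (y - t)\<bar> < \<bar>y - t\<bar> / real (Suc k)"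
            using \<delta>(2)[of y] y t(2) unfolding bad_def by auto
          also have "\<dots> \<le> e * \<bar>y - t\<bar>"
            using mult_right_mono[OF less_imp_le[OF k], of "\<bar>y - t\<bar>"] by (simp add: field_simps)
          finally show ?thesis by simp
        qed simp
      qed (use \<delta> t in auto)
    qed
  qed
qed

section \<open>Closure properties of absolute continuity, and monotonicity criteria\<close>

lemma abs_continuous_subinterval:
  assumes "abs_continuous_on_interval c d f" "c \<le> c'" "d' \<le> d"
  shows "abs_continuous_on_interval c' d' f"
  unfolding abs_continuous_on_interval_def
proof (intro allI impI)
  fix \<epsilon> :: real assume "\<epsilon> > 0"
  with assms(1) obtain \<delta> where \<delta>: "\<delta> > 0" "\<forall>(n::nat) u v.
        (\<forall>i<n. c \<le> u i \<and> u i \<le> v i \<and> v i \<le> d) \<and>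
        (\<forall>i<n. \<forall>j<n. i \<noteq> j \<longrightarrow> {u i<..<v i} \<inter> {u j<..<v j} = {}) \<and>
        (\<Sum>i<n. v i - u i) < \<delta>
        \<longrightarrow> (\<Sum>i<n. \<bar>f (v i) - f (u i)\<bar>) < \<epsilon>"
    unfolding abs_continuous_on_interval_def by blast
  have sub: "c \<le> u \<and> u \<le> v \<and> v \<le> d" if "c' \<le> u \<and> u \<le> v \<and> v \<le> d'" for u v
    using that assms(2,3) by linarith
  show "\<exists>\<delta>>0. \<forall>(n::nat) u v.
        (\<forall>i<n. c' \<le> u i \<and> u i \<le> v i \<and> v i \<le> d') \<and>
        (\<forall>i<n. \<forall>j<n. i \<noteq> j \<longrightarrow> {u i<..<v i} \<inter> {u j<..<v j} = {}) \<and>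
        (\<Sum>i<n. v i - u i) < \<delta>
        \<longrightarrow> (\<Sum>i<n. \<bar>f (v i) - f (u i)\<bar>) < \<epsilon>"
    by (intro exI[of _ \<delta>] conjI \<delta>(1) allI impI \<delta>(2)[rule_format]) (use sub in blast)+
qed

lemma abs_continuous_lipschitz:
  fixes f :: "real \<Rightarrow> real"
  assumes "\<And>u v. c \<le> u \<Longrightarrow> u \<le> v \<Longrightarrow> v \<le> d \<Longrightarrow> \<bar>f v - f u\<bar> \<le> C * (v - u)"
  shows "abs_continuous_on_interval c d f"
  unfolding abs_continuous_on_interval_def
proof (intro allI impI exI[of _ "_ / (\<bar>C\<bar> + 1)"] conjI)
  fix \<epsilon> :: real assume \<epsilon>: "\<epsilon> > 0"
  then show "\<epsilon> / (\<bar>C\<bar> + 1) > 0" by simp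
  fix n :: nat and u v :: "nat \<Rightarrow> real"
  assume *: "(\<forall>i<n. c \<le> u i \<and> u i \<le> v i \<and> v i \<le> d) \<and>
        (\<forall>i<n. \<forall>j<n. i \<noteq> j \<longrightarrow> {u i<..<v i} \<inter> {u j<..<v j} = {}) \<and>
        (\<Sum>i<n. v i - u i) < \<epsilon> / (\<bar>C\<bar> + 1)"
  have "(\<Sum>i<n. \<bar>f (v i) - f (u i)\<bar>) \<le> (\<Sum>i<n. (\<bar>C\<bar> + 1) * (v i - u i))"
  proof (rule sum_mono)
    fix i assume "i \<in> {..<n}"
    then have i: "c \<le> u i" "u i \<le> v i" "v i \<le> d" using * by auto
    from assms[OF this] have "\<bar>f (v i) - f (u i)\<bar> \<le> C * (v i - u i)" .
    also have "\<dots> \<le> (\<bar>C\<bar> + 1) * (v i - u i)" using i by (intro mult_right_mono) auto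
    finally show "\<bar>f (v i) - f (u i)\<bar> \<le> (\<bar>C\<bar> + 1) * (v i - u i)" .
  qed
  also have "\<dots> = (\<bar>C\<bar> + 1) * (\<Sum>i<n. v i - u i)" by (simp add: sum_distrib_left)
  also have "\<dots> < \<epsilon>" using * by (simp add: pos_less_divide_eq mult.commute)
  finally show "(\<Sum>i<n. \<bar>f (v i) - f (u i)\<bar>) < \<epsilon>" .
qed

lemma abs_continuous_add:
  fixes f g :: "real \<Rightarrow> real"
  assumes f: "abs_continuous_on_interval c d f" and g: "abs_continuous_on_interval c d g"
  shows "abs_continuous_on_interval c d (\<lambda>t. f t + g t)"
  unfolding abs_continuous_on_interval_def
proof (intro allI impI)
  fix \<epsilon> :: real assume "\<epsilon> > 0"
  then have e2: "\<epsilon> / 2 > 0" by simp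
  obtain \<delta>1 where \<delta>1: "\<delta>1 > 0" "\<forall>(n::nat) u v.
        (\<forall>i<n. c \<le> u i \<and> u i \<le> v i \<and> v i \<le> d) \<and>
        (\<forall>i<n. \<forall>j<n. i \<noteq> j \<longrightarrow> {u i<..<v i} \<inter> {u j<..<v j} = {}) \<and>
        (\<Sum>i<n. v i - u i) < \<delta>1
        \<longrightarrow> (\<Sum>i<n. \<bar>f (v i) - f (u i)\<bar>) < \<epsilon> / 2"
    using f e2 unfolding abs_continuous_on_interval_def by blast
  obtain \<delta>2 where \<delta>2: "\<delta>2 > 0" "\<forall>(n::nat) u v.
        (\<forall>i<n. c \<le> u i \<and> u i \<le> v i \<and> v i \<le> d) \<and>
        (\<forall>i<n. \<forall>j<n. i \<noteq> j \<longrightarrow> {u i<..<v i} \<inter> {u j<..<v j} = {}) \<and>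
        (\<Sum>i<n. v i - u i) < \<delta>2
        \<longrightarrow> (\<Sum>i<n. \<bar>g (v i) - g (u i)\<bar>) < \<epsilon> / 2"
    using g e2 unfolding abs_continuous_on_interval_def by blast
  show "\<exists>\<delta>>0. \<forall>(n::nat) u v.
        (\<forall>i<n. c \<le> u i \<and> u i \<le> v i \<and> v i \<le> d) \<and>
        (\<forall>i<n. \<forall>j<n. i \<noteq> j \<longrightarrow> {u i<..<v i} \<inter> {u j<..<v j} = {}) \<and>
        (\<Sum>i<n. v i - u i) < \<delta>
        \<longrightarrow> (\<Sum>i<n. \<bar>(f (v i) + g (v i)) - (f (u i) + g (u i))\<bar>) < \<epsilon>"
  proof (intro exI[of _ "min \<delta>1 \<delta>2"] conjI allI impI)
    fix n :: nat and u v :: "nat \<Rightarrow> real"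
    assume *: "(\<forall>i<n. c \<le> u i \<and> u i \<le> v i \<and> v i \<le> d) \<and>
        (\<forall>i<n. \<forall>j<n. i \<noteq> j \<longrightarrow> {u i<..<v i} \<inter> {u j<..<v j} = {}) \<and>
        (\<Sum>i<n. v i - u i) < min \<delta>1 \<delta>2"
    have "(\<Sum>i<n. \<bar>(f (v i) + g (v i)) - (f (u i) + g (u i))\<bar>)
        \<le> (\<Sum>i<n. \<bar>f (v i) - f (u i)\<bar> + \<bar>g (v i) - g (u i)\<bar>)"
      by (intro sum_mono) linarith
    also have "\<dots> = (\<Sum>i<n. \<bar>f (v i) - f (u i)\<bar>) + (\<Sum>i<n. \<bar>g (v i) - g (u i)\<bar>)"
      by (rule sum.distrib)
    also have "\<dots> < \<epsilon> / 2 + \<epsilon> / 2"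
      by (intro add_strict_mono \<delta>1(2)[rule_format] \<delta>2(2)[rule_format]) (use * in auto)
    finally show "(\<Sum>i<n. \<bar>(f (v i) + g (v i)) - (f (u i) + g (u i))\<bar>) < \<epsilon>" by simp
  qed (use \<delta>1 \<delta>2 in auto)
qed

lemma abs_continuous_uminus:
  "abs_continuous_on_interval c d f \<Longrightarrow> abs_continuous_on_interval c d (\<lambda>t. - f t)"
  unfolding abs_continuous_on_interval_def by (simp add: abs_minus_commute)

lemma abs_continuous_imp_continuous_on:
  assumes "abs_continuous_on_interval c d f"
  shows "continuous_on {c..d} f"
  unfolding continuous_on_iff
proof (intro ballI allI impI)
  fix t e :: real assume t: "t \<in> {c..d}" and e: "e > 0"
  with assms obtain \<delta> where \<delta>: "\<delta> > 0" "\<forall>(n::nat) u v.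
        (\<forall>i<n. c \<le> u i \<and> u i \<le> v i \<and> v i \<le> d) \<and>
        (\<forall>i<n. \<forall>j<n. i \<noteq> j \<longrightarrow> {u i<..<v i} \<inter> {u j<..<v j} = {}) \<and>
        (\<Sum>i<n. v i - u i) < \<delta>
        \<longrightarrow> (\<Sum>i<n. \<bar>f (v i) - f (u i)\<bar>) < e"
    unfolding abs_continuous_on_interval_def by blast
  show "\<exists>\<delta>>0. \<forall>y\<in>{c..d}. dist y t < \<delta> \<longrightarrow> dist (f y) (f t) < e"
  proof (intro exI[of _ \<delta>] conjI ballI impI \<delta>(1))
    fix y assume y: "y \<in> {c..d}" "dist y t < \<delta>"
    have "\<bar>f (max y t) - f (min y t)\<bar> < e"
      using \<delta>(2)[rule_format, of 1 "\<lambda>_. min y t" "\<lambda>_. max y t"] y t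
      by (cases "y \<le> t") (auto simp: dist_real_def)
    then show "dist (f y) (f t) < e" by (auto simp: dist_real_def min_def max_def split: if_splits)
  qed
qed

lemma has_real_derivative_straddle:
  assumes f: "(f has_real_derivative f') (at t)" and "\<epsilon> > 0"
  obtains \<delta> where "\<delta> > 0"
    "\<And>u v. u \<le> t \<Longrightarrow> t \<le> v \<Longrightarrow> v - u < \<delta> \<Longrightarrow> \<bar>f v - f u - f' * (v - u)\<bar> \<le> \<epsilon> * (v - u)"
proof -
  obtain \<delta> where \<delta>: "\<delta> > 0" "\<And>y. norm (y - t) < \<delta> \<Longrightarrow> norm (f y - f t - f' * (y - t)) \<le> \<epsilon> * norm (y - t)"
    using f \<open>\<epsilon> > 0\<close> unfolding has_field_derivative_def has_derivative_at_alt by blast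
  show thesis
  proof (rule that[OF \<delta>(1)])
    fix u v assume uv: "u \<le> t" "t \<le> v" "v - u < \<delta>"
    have "\<bar>f u - f t - f' * (u - t)\<bar> \<le> \<epsilon> * (t - u)" "\<bar>f v - f t - f' * (v - t)\<bar> \<le> \<epsilon> * (v - t)"
      using \<delta>(2)[of u] \<delta>(2)[of v] uv by auto
    then show "\<bar>f v - f u - f' * (v - u)\<bar> \<le> \<epsilon> * (v - u)"
      by (simp add: algebra_simps abs_le_iff)
  qed
qed

lemma abs_continuous_deriv_nonneg_imp_le:
  assumes ac: "abs_continuous_on_interval c d f" and cd: "c \<le> d"
    and deriv: "AE t in lebesgue. c \<le> t \<and> t \<le> d \<longrightarrow> (\<exists>f'\<ge>0. (f has_real_derivative f') (at t))"
  shows "f c \<le> f d"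
proof (rule abs_continuous_mono_dini[OF ac cd])
  show "AE t in lebesgue. c \<le> t \<and> t \<le> d \<longrightarrow>
      (\<forall>\<epsilon>>0. \<exists>\<delta>>0. \<forall>u v. c \<le> u \<and> u \<le> t \<and> t \<le> v \<and> v \<le> d \<and> v - u < \<delta> \<longrightarrow>
        - \<epsilon> * (v - u) \<le> f v - f u)"
    using deriv
  proof (eventually_elim, intro impI allI)
    fix t \<epsilon> :: real
    assume "c \<le> t \<and> t \<le> d \<longrightarrow> (\<exists>f'\<ge>0. (f has_real_derivative f') (at t))" "c \<le> t \<and> t \<le> d" "\<epsilon> > 0"
    then obtain f' where f': "f' \<ge> 0" "(f has_real_derivative f') (at t)" by blast
    obtain \<delta> where \<delta>: "\<delta> > 0"
      "\<And>u v. u \<le> t \<Longrightarrow> t \<le> v \<Longrightarrow> v - u < \<delta> \<Longrightarrow> \<bar>f v - f u - f' * (v - u)\<bar> \<le> \<epsilon> * (v - u)"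
      using has_real_derivative_straddle[OF f'(2) \<open>\<epsilon> > 0\<close>] by blast
    show "\<exists>\<delta>>0. \<forall>u v. c \<le> u \<and> u \<le> t \<and> t \<le> v \<and> v \<le> d \<and> v - u < \<delta> \<longrightarrow> - \<epsilon> * (v - u) \<le> f v - f u"
    proof (intro exI[of _ \<delta>] conjI allI impI \<delta>(1))
      fix u v assume uv: "c \<le> u \<and> u \<le> t \<and> t \<le> v \<and> v \<le> d \<and> v - u < \<delta>"
      then have "f' * (v - u) \<ge> 0" using f' by simp
      with \<delta>(2)[of u v] uv show "- \<epsilon> * (v - u) \<le> f v - f u" by (auto simp: abs_le_iff)
    qed
  qed
qed

text \<open>If \<open>c r < c s\<close>, take a point \<open>p\<close> of global maximum and the
  first later \<open>q\<close> where \<open>c\<close> has dropped to a level slightly below.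
  Throughout \<open>[p, q]\<close> the function is within \<open>\<eta>\<close> of its running
  maximum, so \<open>step\<close> yields \<open>c p \<le> c q\<close>, which is absurd. This makes
  an inequality global that is known only near running maxima.\<close>

lemma running_max_imp_le:
  fixes c :: "real \<Rightarrow> real"
  assumes cont: "continuous_on {s..r} c" and sr: "s \<le> r" and "\<eta> > 0"
    and step: "\<And>p q. s \<le> p \<Longrightarrow> p \<le> q \<Longrightarrow> q \<le> r \<Longrightarrow>
      (\<And>t v. p \<le> t \<Longrightarrow> t \<le> q \<Longrightarrow> s \<le> v \<Longrightarrow> v \<le> t \<Longrightarrow> c v < c t + \<eta>) \<Longrightarrow> c p \<le> c q"
  shows "c s \<le> c r"
proof (rule ccontr)
  assume less: "\<not> c s \<le> c r"
  obtain p where p: "p \<in> {s..r}" "\<And>t. t \<in> {s..r} \<Longrightarrow> c t \<le> c p"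
    using continuous_attains_sup[OF compact_Icc _ cont] sr by auto
  \<comment> \<open>Half of \<open>\<eta>\<close> makes the closeness strict; the maximum with
    \<open>c r\<close> ensures that the level is reached by the time \<open>r\<close>.\<close>
  define l where "l = max (c r) (c p - \<eta> / 2)"
  have "c r < c p" using less p(2)[of s] sr by simp
  then have l: "l < c p" "c r \<le> l" "c p - \<eta> / 2 \<le> l" using \<open>\<eta> > 0\<close> by (auto simp: l_def)
  have contp: "continuous_on {p..r} c" using cont p by (auto intro: continuous_on_subset)
  define S where "S = {t \<in> {p..r}. c t \<le> l}"
  have "closed S" unfolding S_def
    by (intro continuous_on_closed_Collect_le contp continuous_on_const) auto
  moreover have "r \<in> S" using l p by (auto simp: S_def)
  moreover have bb: "bdd_below S" by (auto simp: S_def intro: bdd_belowI[of _ p])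
  ultimately have q: "Inf S \<in> S" by (intro closed_contains_Inf) auto
  define q where "q = Inf S"
  have q: "p \<le> q" "q \<le> r" "c q \<le> l" using q by (auto simp: S_def q_def)
  have above: "l \<le> c t" if "p \<le> t" "t \<le> q" for t
  proof (rule ccontr)
    assume "\<not> l \<le> c t"
    then have "\<exists>t'\<ge>p. t' \<le> t \<and> c t' = l"
      using l that q by (intro IVT2') (auto intro: continuous_on_subset[OF contp])
    then obtain t' where t': "p \<le> t'" "t' \<le> t" "c t' = l" by blast
    have "t' \<noteq> t" using t' \<open>\<not> l \<le> c t\<close> by auto
    moreover have "t' \<in> S" using t' that q by (auto simp: S_def)
    then have "q \<le> t'" unfolding q_def using bb by (rule cInf_lower)
    ultimately show False using t' that by linarith
  qed
  have "c p \<le> c q"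
  proof (rule step)
    fix t v assume tv: "p \<le> t" "t \<le> q" "s \<le> v" "v \<le> t"
    have "c v \<le> c p" using p(2) tv q by simp
    also have "\<dots> < c t + \<eta>" using above[OF tv(1,2)] l \<open>\<eta> > 0\<close> by linarith
    finally show "c v < c t + \<eta>" .
  qed (use p q in auto)
  with q l show False by linarith
qed

lemma continuous_on_atLeast:
  fixes f :: "real \<Rightarrow> real"
  assumes "\<And>d. s < d \<Longrightarrow> continuous_on {s..d} f"
  shows "continuous_on {s..} f"
  unfolding continuous_on_eq_continuous_within
proof
  fix t assume t: "t \<in> {s..}"
  have "continuous_on {s..t+1} f" using t by (intro assms) auto
  then have "continuous (at t within {s..t+1}) f" using t by (simp add: continuous_on_eq_continuous_within)
  moreover have "at t within {s..t+1} = at t within {s..}"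
    by (rule at_within_nhd[of t "{t-1<..<t+1}"]) auto
  ultimately show "continuous (at t within {s..}) f" by (simp add: continuous_within)
qed

section \<open>The comparison polygon\<close>

text \<open>Write \<open>z = 1 + x\<close> for a solution with \<open>\<bar>x\<bar> \<le> 1\<close>, and measure time by the integral of the
  coefficients. If the history lies above a line of slope \<open>z / U\<close> through the current value, then
  \<open>z' \<le> 1 - z + z * T / U\<close>. The polygon below is an explicit Euler scheme, rounded in the safe
  direction, for the inverse \<open>U(z)\<close> of the extremal solution with \<open>T = 13679/10000 > 1 + 1/e\<close> and
  \<open>U(z) = z\<close> for small \<open>z\<close>. A piece \<open>(p, q, \<alpha>)\<close> is the line of slope \<open>\<alpha>\<close> through \<open>(p, q)\<close>. At
  \<open>z = 1999/1000\<close> the bound for \<open>z'\<close> is negative, which is why the last slope may be any large number.\<close>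

definition inner_pieces :: "(real \<times> real \<times> real) list" where
  "inner_pieces =
    [(0, 0, 1), (1459/1000, 1459/1000, 11/10), (1560/1000, 1570/1000, 125/100),
     (1636/1000, 1665/1000, 141/100), (1712/1000, 1772/1000, 164/100),
     (1773/1000, 1872/1000, 191/100), (1827/1000, 1975/1000, 228/100),
     (1877/1000, 2089/1000, 284/100), (1913/1000, 2191/1000, 355/100),
     (1944/1000, 2301/1000, 472/100), (1965/1000, 2400/1000, 645/100),
     (1983/1000, 2516/1000, 1051/100), (1993/1000, 2621/1000, 2121/100)]"

definition pieces :: "real \<Rightarrow> (real \<times> real \<times> real) list" where
  "pieces lam = inner_pieces @ [(1999/1000, 2748/1000, lam)]"

fun line :: "real \<times> real \<times> real \<Rightarrow> real \<Rightarrow> real" where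
  "line (p, q, \<alpha>) z = q + \<alpha> * (z - p)"

text \<open>The slopes increase from piece to piece (for \<open>lam\<close> at least
  \<open>22\<close>), so the maximum of the lines is a convex polygon through the vertices, up to
  the downward rounding of their second coordinates. As a maximum it can be treated line by
  line.\<close>

definition polygon :: "real \<Rightarrow> real \<Rightarrow> real" where
  "polygon lam z = Max ((\<lambda>l. line l z) ` set (pieces lam))"

lemma line_le_polygon: "l \<in> set (pieces lam) \<Longrightarrow> line l z \<le> polygon lam z"
  unfolding polygon_def by (intro Max_ge) auto

lemma polygon_attained: "\<exists>l\<in>set (pieces lam). polygon lam z = line l z"
proof -
  have "polygon lam z \<in> (\<lambda>l. line l z) ` set (pieces lam)"
    unfolding polygon_def by (intro Max_in) (auto simp: pieces_def inner_pieces_def)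
  then show ?thesis by auto
qed

lemma polygon_ge: "z \<le> polygon lam z"
  using line_le_polygon[of "(0, 0, 1)" lam z] by (simp add: pieces_def inner_pieces_def)

text \<open>The bound \<open>22\<close> exceeds the last fixed slope \<open>2121/100\<close>; it
  keeps the final line below the polygon to the left of its vertex.\<close>

lemma polygon_1:
  assumes "22 \<le> lam"
  shows "polygon lam 1 \<le> 1"
proof -
  have "\<forall>l\<in>set (pieces lam). line l 1 \<le> 1"
    using assms by (simp add: pieces_def inner_pieces_def)
  then show ?thesis using polygon_attained[of lam 1] by auto
qed

lemma polygon_last: "2748/1000 + lam * (z - 1999/1000) \<le> polygon lam z"
  using line_le_polygon[of "(1999/1000, 2748/1000, lam)" lam z] by (simp add: pieces_def inner_pieces_def)

lemma pieces_slope: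
  assumes "(p, q, \<alpha>) \<in> set (pieces lam)" "22 \<le> lam"
  shows "1 \<le> \<alpha>" "\<alpha> \<le> lam" "q \<le> \<alpha> * p"
proof -
  have "\<forall>(p, q, \<alpha>)\<in>set (pieces lam). 1 \<le> \<alpha> \<and> \<alpha> \<le> lam \<and> q \<le> \<alpha> * p"
    using assms(2) by (simp add: pieces_def inner_pieces_def)
  then show "1 \<le> \<alpha>" "\<alpha> \<le> lam" "q \<le> \<alpha> * p" using assms(1) by blast+
qed

text \<open>Every line has a value at most \<open>0\<close> at the origin
  (\<open>q \<le> \<alpha> * p\<close>), hence lies below its own chords from the origin, and the
  maximum inherits this. It turns a bound on polygon values in the past into a bound on past values
  that is affine in the delay.\<close>

lemma polygon_star:
  assumes "22 \<le> lam" "0 \<le> w" "w \<le> z" "0 < z"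
  shows "polygon lam w \<le> w / z * polygon lam z"
proof -
  obtain p q \<alpha> where l: "(p, q, \<alpha>) \<in> set (pieces lam)" "polygon lam w = line (p, q, \<alpha>) w"
    using polygon_attained[of lam w] by auto
  define \<mu> where "\<mu> = w / z"
  have \<mu>: "0 \<le> \<mu>" "\<mu> \<le> 1" "w = \<mu> * z" using assms by (auto simp: \<mu>_def)
  have "(1 - \<mu>) * (\<alpha> * p - q) \<ge> 0"
    using \<mu> pieces_slope[OF l(1) assms(1)] by (intro mult_nonneg_nonneg) auto
  then have "line (p, q, \<alpha>) w \<le> \<mu> * line (p, q, \<alpha>) z" by (simp add: \<mu>(3) algebra_simps)
  also have "\<dots> \<le> \<mu> * polygon lam z" using line_le_polygon[OF l(1)] \<mu> by (intro mult_left_mono) auto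
  finally show ?thesis using l by (simp add: \<mu>_def)
qed

lemma polygon_lipschitz:
  assumes "22 \<le> lam"
  shows "\<bar>polygon lam w - polygon lam z\<bar> \<le> lam * \<bar>w - z\<bar>"
proof -
  have *: "polygon lam w \<le> polygon lam z + lam * \<bar>w - z\<bar>" for w z
  proof -
    obtain p q \<alpha> where l: "(p, q, \<alpha>) \<in> set (pieces lam)" "polygon lam w = line (p, q, \<alpha>) w"
      using polygon_attained[of lam w] by auto
    have "line (p, q, \<alpha>) w = line (p, q, \<alpha>) z + \<alpha> * (w - z)" by (simp add: algebra_simps)
    also have "\<alpha> * (w - z) \<le> \<alpha> * \<bar>w - z\<bar>"
      using pieces_slope[OF l(1) assms] by (intro mult_left_mono) auto
    also have "\<dots> \<le> lam * \<bar>w - z\<bar>"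
      using pieces_slope[OF l(1) assms] by (intro mult_right_mono) auto
    finally show ?thesis using line_le_polygon[OF l(1), of z] l(2) by linarith
  qed
  show ?thesis using *[of w z] *[of z w] by (simp add: abs_le_iff abs_minus_commute)
qed

text \<open>A steeper line overtakes a flatter one only to the right of a point where it is not yet
  above. With the flatter line taken from an earlier piece, an active line is confined to the right
  of its vertex.\<close>

lemma line_crossing:
  fixes z :: real
  assumes "q1 + a1 * (z - p1) \<le> s" "s = q + a * (z - p)" "a1 < a" "q \<le> q1 + a1 * (p - p1)"
  shows "p \<le> z"
proof (rule ccontr)
  assume "\<not> p \<le> z"
  then have "a * (z - p) < a1 * (z - p)" using assms(3) by simp
  moreover have "a1 * (z - p1) = a1 * (z - p) + a1 * (p - p1)" by (simp add: algebra_simps)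
  ultimately show False using assms by linarith
qed

text \<open>The arithmetic inequality is the Euler condition at the vertex: divided by
  \<open>q\<close>, it says \<open>\<alpha> * (1 - p + p * T / q) \<le> 1\<close> with
  \<open>T = 13679/10000\<close>. At the last vertex the bracket is negative, so every slope
  qualifies.\<close>

lemma active_piece:
  assumes l: "(p, q, \<alpha>) \<in> set (pieces lam)" and lam: "22 \<le> lam"
    and act: "polygon lam z = line (p, q, \<alpha>) z"
  shows "\<alpha> = 1 \<or> (p \<le> z \<and> 1 \<le> p \<and> 1 \<le> q \<and> \<alpha> * ((1 - p) * q + p * (13679/10000)) \<le> q)"
proof -
  define s where "s = polygon lam z"
  have ge: "\<forall>l\<in>set inner_pieces. line l z \<le> s"
    using line_le_polygon by (simp add: s_def pieces_def)
  have inner: "\<forall>l\<in>set inner_pieces. s = line l z \<longrightarrow> (case l of (p, q, \<alpha>) \<Rightarrow> \<alpha> = 1 \<or>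
      (p \<le> z \<and> 1 \<le> p \<and> 1 \<le> q \<and> \<alpha> * ((1 - p) * q + p * (13679/10000)) \<le> q))"
    \<comment> \<open>The first premise of \<open>line_crossing\<close> is found by backtracking
      over the inequalities for all pieces, until one with a smaller slope that passes above the
      vertex fits.\<close>
    using ge unfolding inner_pieces_def list.set ball_simps line.simps prod.case
    by (elim conjE, intro conjI impI)
       ((rule TrueI | (rule disjI1, rule refl) |
         (rule disjI2, rule conjI,
          (rule line_crossing, assumption, assumption, (simp (no_asm); fail), (simp (no_asm); fail)),
          (rule conjI, simp (no_asm), rule conjI, simp (no_asm), simp (no_asm))))+)
  consider "p = 1999/1000" "q = 2748/1000" "\<alpha> = lam" | "(p, q, \<alpha>) \<in> set inner_pieces"
    using l unfolding pieces_def by auto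
  then show ?thesis
  proof cases
    case 1
    have "1999/1000 \<le> z"
    proof (rule ccontr)
      assume z: "\<not> 1999/1000 \<le> z"
      then have "lam * (z - 1999/1000) \<le> 22 * (z - 1999/1000)"
        using lam by (intro mult_right_mono_neg) auto
      moreover have "2621/1000 + 2121/100 * (z - 1993/1000) \<le> s"
        using ge by (simp add: inner_pieces_def)
      moreover have "s = 2748/1000 + lam * (z - 1999/1000)" using act 1 by (simp add: s_def)
      ultimately show False using z by (simp add: field_simps)
    qed
    moreover have "lam * ((1 - 1999/1000) * (2748/1000) + (1999/1000) * (13679/10000)) \<le> (0::real)"
      using lam by (intro mult_nonneg_nonpos) auto
    ultimately show ?thesis unfolding 1 by simp
  next
    case 2
    then show ?thesis using inner act unfolding s_def by blast
  qed
qed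

text \<open>The Euler condition at the vertex only improves along the line: after multiplication by
  the polygon value, moving from \<open>p\<close> to \<open>p + w\<close> subtracts three
  nonnegative terms.\<close>

lemma active_slope_bound:
  assumes l: "(p, q, \<alpha>) \<in> set (pieces lam)" and lam: "22 \<le> lam"
    and act: "polygon lam z = line (p, q, \<alpha>) z" and "\<alpha> \<noteq> 1"
  shows "1 \<le> z" "\<alpha> * (1 - z + z * (13679/10000) / polygon lam z) \<le> 1"
proof -
  define T where "T = (13679/10000 :: real)"
  have pq: "p \<le> z" "1 \<le> p" "1 \<le> q" "\<alpha> * ((1 - p) * q + p * T) \<le> q"
    using active_piece[OF l lam act] \<open>\<alpha> \<noteq> 1\<close> unfolding T_def by auto
  have \<alpha>: "1 \<le> \<alpha>" using pieces_slope[OF l lam] by simp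
  show "1 \<le> z" using pq by simp
  define w where "w = z - p"
  have w: "z = p + w" "0 \<le> w" using pq by (auto simp: w_def)
  have V: "polygon lam z = q + \<alpha> * w" using act by (simp add: w_def)
  have pos: "q + \<alpha> * w > 0" using pq \<alpha> w by (intro add_pos_nonneg) auto
  have "\<alpha> * (1 - z) * (q + \<alpha> * w) + \<alpha> * z * T - (q + \<alpha> * w)
      = (\<alpha> * ((1 - p) * q + p * T) - q) - \<alpha> * w * (q + 1 - T) - \<alpha> * w * ((p - 1) * \<alpha>) - \<alpha> * w * (w * \<alpha>)"
    by (simp add: w algebra_simps)
  moreover have "\<alpha> * w * (q + 1 - T) \<ge> 0"
    using pq \<alpha> w by (auto intro!: mult_nonneg_nonneg simp: T_def)
  moreover have "\<alpha> * w * ((p - 1) * \<alpha>) \<ge> 0" "\<alpha> * w * (w * \<alpha>) \<ge> 0"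
    using pq \<alpha> w by (auto intro!: mult_nonneg_nonneg)
  ultimately have "\<alpha> * (1 - z) * (q + \<alpha> * w) + \<alpha> * z * T \<le> q + \<alpha> * w" using pq(4) by linarith
  then have "(\<alpha> * (1 - z) * (q + \<alpha> * w) + \<alpha> * z * T) / (q + \<alpha> * w) \<le> 1"
    using pos by simp
  moreover have "(\<alpha> * (1 - z) * (q + \<alpha> * w) + \<alpha> * z * T) / (q + \<alpha> * w)
      = \<alpha> * (1 - z + z * T / (q + \<alpha> * w))"
    using pos by (simp add: field_simps)
  ultimately show "\<alpha> * (1 - z + z * (13679/10000) / polygon lam z) \<le> 1" unfolding V T_def by simp
qed

section \<open>Solutions in the time of the integrated coefficients\<close>

text \<open>Substitute for the chain rule at kinks. The function is a minimum of differentiable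
  ones, \<open>B - line l\<close> along \<open>z\<close>; near \<open>t\<close> only the lines
  active at \<open>t\<close> matter, and each of them gives the estimate through its own
  derivative.\<close>

lemma minus_polygon_dini:
  assumes B: "(B has_real_derivative b') (at t)" and z: "(z has_real_derivative z') (at t)"
    and act: "\<And>p q \<alpha>. (p, q, \<alpha>) \<in> set (pieces lam) \<Longrightarrow>
        polygon lam (z t) = line (p, q, \<alpha>) (z t) \<Longrightarrow> \<alpha> * z' \<le> b'"
    and \<epsilon>: "\<epsilon> > 0"
  shows "\<exists>\<delta>>0. \<forall>u v. u \<le> t \<and> t \<le> v \<and> v - u < \<delta> \<longrightarrow>
    - \<epsilon> * (v - u) \<le> (B v - polygon lam (z v)) - (B u - polygon lam (z u))"
proof -
  let ?g = "\<lambda>l s. B s - line l (z s)"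
  let ?P = "\<lambda>l \<delta>. \<delta> > 0 \<and> (\<forall>u v. u \<le> t \<and> t \<le> v \<and> v - u < \<delta> \<longrightarrow>
    - \<epsilon> * (v - u) \<le> ?g l v - (B u - polygon lam (z u)))"
  have upper: "B u - polygon lam (z u) \<le> ?g l u" if "l \<in> set (pieces lam)" for l u
    using line_le_polygon[OF that] by simp
  have deriv: "(?g (p, q, \<alpha>) has_real_derivative (b' - \<alpha> * z')) (at t)" for p q \<alpha>
    unfolding line.simps by (auto intro!: derivative_eq_intros B z)
  obtain l0 where l0: "l0 \<in> set (pieces lam)" "polygon lam (z t) = line l0 (z t)"
    using polygon_attained by blast
  have cont: "isCont (?g l) t" for l
    using deriv by (cases l) (auto intro: DERIV_isCont)
  have "\<exists>\<delta>. ?P l \<delta>" if l: "l \<in> set (pieces lam)" for l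
  proof (cases "polygon lam (z t) = line l (z t)")
    case True
    obtain p q \<alpha> where [simp]: "l = (p, q, \<alpha>)" by (cases l)
    have le: "\<alpha> * z' \<le> b'" using act[of p q \<alpha>] l True by simp
    obtain \<delta> where \<delta>: "\<delta> > 0" "\<And>u v. u \<le> t \<Longrightarrow> t \<le> v \<Longrightarrow> v - u < \<delta> \<Longrightarrow>
        \<bar>?g l v - ?g l u - (b' - \<alpha> * z') * (v - u)\<bar> \<le> \<epsilon> * (v - u)"
      using has_real_derivative_straddle[OF deriv[of p q \<alpha>] \<epsilon>] by auto
    show ?thesis
    proof (intro exI[of _ \<delta>] conjI allI impI \<delta>(1))
      fix u v assume uv: "u \<le> t \<and> t \<le> v \<and> v - u < \<delta>"
      have "(b' - \<alpha> * z') * (v - u) \<ge> 0" using le uv by (intro mult_nonneg_nonneg) auto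
      then have "- \<epsilon> * (v - u) \<le> ?g l v - ?g l u" using \<delta>(2)[of u v] uv by (simp add: abs_le_iff)
      then show "- \<epsilon> * (v - u) \<le> ?g l v - (B u - polygon lam (z u))" using upper[OF l, of u] by linarith
    qed
  next
    case False
    \<comment> \<open>Half the gap at \<open>t\<close> between an inactive line and an active one:
      near \<open>t\<close> each of the two moves by less than \<open>e\<close>, so the gap stays
      open.\<close>
    define e where "e = (?g l t - ?g l0 t) / 2"
    have e: "e > 0" using False line_le_polygon[OF l, of "z t"] l0 by (simp add: e_def)
    obtain \<delta>1 where \<delta>1: "\<delta>1 > 0" "\<And>v. dist v t < \<delta>1 \<Longrightarrow> dist (?g l v) (?g l t) < e"
      using cont[of l] e unfolding continuous_at_eps_delta by blast
    obtain \<delta>2 where \<delta>2: "\<delta>2 > 0" "\<And>v. dist v t < \<delta>2 \<Longrightarrow> dist (?g l0 v) (?g l0 t) < e"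
      using cont[of l0] e unfolding continuous_at_eps_delta by blast
    show ?thesis
    proof (intro exI[of _ "min \<delta>1 \<delta>2"] conjI allI impI)
      fix u v assume uv: "u \<le> t \<and> t \<le> v \<and> v - u < min \<delta>1 \<delta>2"
      have "\<bar>?g l v - ?g l t\<bar> < e" "\<bar>?g l0 u - ?g l0 t\<bar> < e"
        using \<delta>1(2)[of v] \<delta>2(2)[of u] uv by (auto simp: dist_real_def)
      moreover have "?g l t - ?g l0 t = 2 * e" by (simp add: e_def)
      ultimately have "?g l v - ?g l0 u \<ge> 0" by linarith
      moreover have "\<epsilon> * (v - u) \<ge> 0" using uv \<epsilon> by simp
      ultimately show "- \<epsilon> * (v - u) \<le> ?g l v - (B u - polygon lam (z u))"
        using upper[OF l0(1), of u] by simp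
    qed (use \<delta>1 \<delta>2 in auto)
  qed
  then obtain \<delta> where \<delta>: "\<And>l. l \<in> set (pieces lam) \<Longrightarrow> ?P l (\<delta> l)" by metis
  show ?thesis
  proof (intro exI[of _ "Min (\<delta> ` set (pieces lam))"] conjI allI impI)
    show "0 < Min (\<delta> ` set (pieces lam))" using \<delta> by (subst Min_gr_iff) (auto simp: pieces_def)
    fix u v assume uv: "u \<le> t \<and> t \<le> v \<and> v - u < Min (\<delta> ` set (pieces lam))"
    obtain l where l: "l \<in> set (pieces lam)" "polygon lam (z v) = line l (z v)"
      using polygon_attained by blast
    have "v - u < \<delta> l" using uv l(1) by (auto intro: less_le_trans)
    then show "- \<epsilon> * (v - u) \<le> (B v - polygon lam (z v)) - (B u - polygon lam (z u))"
      using \<delta>[OF l(1)] uv l(2) by auto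
  qed
qed

text \<open>The equation without initial data, which makes the notion stable under scaling and
  differences; the history is whatever \<open>x\<close> does to the left of
  \<open>s\<close>.\<close>

definition solves where
  "solves m a h s x \<longleftrightarrow> locally_abs_continuous_from s x \<and>
    (AE t in lebesgue. s \<le> t \<longrightarrow>
      (x has_real_derivative - (\<Sum>k=1..m. a k t * x (h k t))) (at t))"

lemma solves_uminus: "solves m a h s x \<Longrightarrow> solves m a h s (\<lambda>t. - x t)"
  unfolding solves_def locally_abs_continuous_from_def
  by (auto simp: sum_negf intro!: abs_continuous_uminus DERIV_minus elim!: eventually_mono
      dest: DERIV_minus)

lemma abs_continuous_cmult:
  fixes x :: "real \<Rightarrow> real"
  assumes x: "abs_continuous_on_interval s d x"
  shows "abs_continuous_on_interval s d (\<lambda>t. c * x t)"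
  unfolding abs_continuous_on_interval_def
proof (intro allI impI)
  fix \<epsilon> :: real assume "\<epsilon> > 0"
  then have "\<epsilon> / (\<bar>c\<bar> + 1) > 0" by simp
  with x obtain \<delta> where \<delta>: "\<delta> > 0" "\<forall>(n::nat) u v.
        (\<forall>i<n. s \<le> u i \<and> u i \<le> v i \<and> v i \<le> d) \<and>
        (\<forall>i<n. \<forall>j<n. i \<noteq> j \<longrightarrow> {u i<..<v i} \<inter> {u j<..<v j} = {}) \<and>
        (\<Sum>i<n. v i - u i) < \<delta>
        \<longrightarrow> (\<Sum>i<n. \<bar>x (v i) - x (u i)\<bar>) < \<epsilon> / (\<bar>c\<bar> + 1)"
    unfolding abs_continuous_on_interval_def by blast
  show "\<exists>\<delta>>0. \<forall>(n::nat) u v.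
        (\<forall>i<n. s \<le> u i \<and> u i \<le> v i \<and> v i \<le> d) \<and>
        (\<forall>i<n. \<forall>j<n. i \<noteq> j \<longrightarrow> {u i<..<v i} \<inter> {u j<..<v j} = {}) \<and>
        (\<Sum>i<n. v i - u i) < \<delta>
        \<longrightarrow> (\<Sum>i<n. \<bar>c * x (v i) - c * x (u i)\<bar>) < \<epsilon>"
  proof (intro exI[of _ \<delta>] conjI \<delta>(1) allI impI)
    fix n :: nat and u v :: "nat \<Rightarrow> real"
    assume "(\<forall>i<n. s \<le> u i \<and> u i \<le> v i \<and> v i \<le> d) \<and>
        (\<forall>i<n. \<forall>j<n. i \<noteq> j \<longrightarrow> {u i<..<v i} \<inter> {u j<..<v j} = {}) \<and>
        (\<Sum>i<n. v i - u i) < \<delta>"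
    then have less: "(\<Sum>i<n. \<bar>x (v i) - x (u i)\<bar>) < \<epsilon> / (\<bar>c\<bar> + 1)" using \<delta>(2) by blast
    have "(\<Sum>i<n. \<bar>c * x (v i) - c * x (u i)\<bar>) = \<bar>c\<bar> * (\<Sum>i<n. \<bar>x (v i) - x (u i)\<bar>)"
      by (simp add: sum_distrib_left abs_mult right_diff_distrib[symmetric])
    also have "\<dots> \<le> (\<bar>c\<bar> + 1) * (\<Sum>i<n. \<bar>x (v i) - x (u i)\<bar>)"
      by (intro mult_right_mono sum_nonneg) auto
    also have "\<dots> < \<epsilon>" using less by (simp add: pos_less_divide_eq mult.commute)
    finally show "(\<Sum>i<n. \<bar>c * x (v i) - c * x (u i)\<bar>) < \<epsilon>" .
  qed
qed

lemma solves_scale: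
  assumes "solves m a h s x"
  shows "solves m a h s (\<lambda>t. c * x t)"
proof -
  have "AE t in lebesgue. s \<le> t \<longrightarrow>
      ((\<lambda>t. c * x t) has_real_derivative - (\<Sum>k=1..m. a k t * (c * x (h k t)))) (at t)"
    using assms[unfolded solves_def, THEN conjunct2]
  proof (eventually_elim, intro impI)
    fix t assume "s \<le> t \<longrightarrow> (x has_real_derivative - (\<Sum>k=1..m. a k t * x (h k t))) (at t)" "s \<le> t"
    then have "((\<lambda>t. c * x t) has_real_derivative c * - (\<Sum>k=1..m. a k t * x (h k t))) (at t)"
      by (intro DERIV_cmult) auto
    then show "((\<lambda>t. c * x t) has_real_derivative - (\<Sum>k=1..m. a k t * (c * x (h k t)))) (at t)"
      by (simp add: sum_distrib_left mult.left_commute)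
  qed
  then show ?thesis using assms abs_continuous_cmult
    unfolding solves_def locally_abs_continuous_from_def by blast
qed

text \<open>\<open>B\<close> is the new time, of which only monotonicity, Lipschitz continuity and
  the derivative almost everywhere are retained. From \<open>ts\<close> on, \<open>D\<close> bounds
  each delay and \<open>T'\<close> the mean delay in this time. The mean is stated as a product,
  which makes sense also where the coefficients vanish.\<close>

locale delay_equation =
  fixes m :: nat and a h :: "nat \<Rightarrow> real \<Rightarrow> real" and B :: "real \<Rightarrow> real" and C D T' ts :: real
  assumes h_le: "\<And>k t. k \<in> {1..m} \<Longrightarrow> 0 \<le> t \<Longrightarrow> h k t \<le> t"
    and B_mono: "\<And>s t. 0 \<le> s \<Longrightarrow> s \<le> t \<Longrightarrow> B s \<le> B t"
    and B_lipschitz: "\<And>s t. 0 \<le> s \<Longrightarrow> s \<le> t \<Longrightarrow> B t - B s \<le> C * (t - s)"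
    and B_deriv: "AE t in lebesgue. 0 \<le> t \<longrightarrow>
      (B has_real_derivative (\<Sum>k=1..m. a k t)) (at t) \<and> (\<forall>k\<in>{1..m}. 0 \<le> a k t)"
    and ts: "0 \<le> ts" and D: "0 < D" and T': "T' < 13679/10000"
    and delay_bounded: "\<And>k t. k \<in> {1..m} \<Longrightarrow> ts \<le> t \<Longrightarrow> 0 \<le> h k t \<and> B t - B (h k t) \<le> D"
    and mean_delay: "AE t in lebesgue. ts \<le> t \<longrightarrow>
      (\<Sum>k=1..m. a k t * (B t - B (h k t))) \<le> T' * (\<Sum>k=1..m. a k t)"
    and B_unbounded: "\<And>c. \<exists>t\<ge>0. c \<le> B t"
begin

lemma solves_ac: "solves m a h s x \<Longrightarrow> s \<le> p \<Longrightarrow> p \<le> q \<Longrightarrow> abs_continuous_on_interval p q x"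
  unfolding solves_def locally_abs_continuous_from_def
  by (auto intro: abs_continuous_subinterval[of s "q + 1"])

lemma solves_continuous: "solves m a h s x \<Longrightarrow> continuous_on {s..} x"
  by (intro continuous_on_atLeast abs_continuous_imp_continuous_on solves_ac) auto

lemma B_ac: "0 \<le> p \<Longrightarrow> abs_continuous_on_interval p q B"
  using B_mono B_lipschitz by (intro abs_continuous_lipschitz[of _ _ _ C]) auto

lemma B_continuous: "continuous_on {0..} B"
  by (intro continuous_on_atLeast abs_continuous_imp_continuous_on B_ac) auto

lemma B_reaches:
  assumes "0 \<le> s" "0 \<le> c"
  shows "\<exists>t\<ge>s. B t = B s + c"
proof -
  obtain t where t: "0 \<le> t" "B s + c \<le> B t" using B_unbounded by blast
  have "B t \<le> B (max s t)" using t by (intro B_mono) auto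
  then have "\<exists>r\<ge>s. r \<le> max s t \<and> B r = B s + c"
    using assms t by (intro IVT') (auto intro: continuous_on_subset[OF B_continuous])
  then show ?thesis by blast
qed

text \<open>\<open>A * B - x\<close> has a nonnegative derivative. No sign of \<open>A\<close> is
  assumed: a negative \<open>A\<close> gives a guaranteed decrease.\<close>

lemma solution_increment_le:
  assumes x: "solves m a h s x" and s: "0 \<le> s" "s \<le> p" "p \<le> q"
    and bound: "\<And>k t. k \<in> {1..m} \<Longrightarrow> p \<le> t \<Longrightarrow> t \<le> q \<Longrightarrow> - A \<le> x (h k t)"
  shows "x q - x p \<le> A * (B q - B p)"
proof -
  define f where "f t = A * B t + - x t" for t
  have "f p \<le> f q"
  proof (rule abs_continuous_deriv_nonneg_imp_le[where c = p and d = q and f = f])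
    show "abs_continuous_on_interval p q f" unfolding f_def[abs_def]
      using solves_ac[OF x] s
      by (intro abs_continuous_add abs_continuous_uminus abs_continuous_cmult B_ac) auto
    show "AE t in lebesgue. p \<le> t \<and> t \<le> q \<longrightarrow> (\<exists>f'\<ge>0. (f has_real_derivative f') (at t))"
      using B_deriv x[unfolded solves_def, THEN conjunct2]
    proof (eventually_elim, intro impI)
      fix t assume *: "0 \<le> t \<longrightarrow> (B has_real_derivative (\<Sum>k=1..m. a k t)) (at t) \<and> (\<forall>k\<in>{1..m}. 0 \<le> a k t)"
        "s \<le> t \<longrightarrow> (x has_real_derivative - (\<Sum>k=1..m. a k t * x (h k t))) (at t)" "p \<le> t \<and> t \<le> q"
      then have "(f has_real_derivative A * (\<Sum>k=1..m. a k t) + - (- (\<Sum>k=1..m. a k t * x (h k t)))) (at t)"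
        unfolding f_def[abs_def] using s by (intro DERIV_add DERIV_minus DERIV_cmult) auto
      moreover have "0 \<le> (\<Sum>k=1..m. a k t * (A + x (h k t)))"
      proof (intro sum_nonneg mult_nonneg_nonneg)
        fix k assume k: "k \<in> {1..m}"
        show "0 \<le> a k t" using * s k by auto
        show "0 \<le> A + x (h k t)" using bound[OF k, of t] *(3) by linarith
      qed
      then have "0 \<le> A * (\<Sum>k=1..m. a k t) + - (- (\<Sum>k=1..m. a k t * x (h k t)))"
        by (simp add: algebra_simps sum.distrib sum_distrib_left)
      ultimately show "\<exists>f'\<ge>0. (f has_real_derivative f') (at t)" by blast
    qed
  qed fact
  then show ?thesis by (simp add: f_def algebra_simps)
qed

lemma solution_increment_abs_le:
  assumes x: "solves m a h s x" and s: "0 \<le> s" "s \<le> p" "p \<le> q"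
    and bound: "\<And>k t. k \<in> {1..m} \<Longrightarrow> p \<le> t \<Longrightarrow> t \<le> q \<Longrightarrow> \<bar>x (h k t)\<bar> \<le> A"
  shows "\<bar>x q - x p\<bar> \<le> A * (B q - B p)"
proof -
  have "- A \<le> x (h k t)" "- A \<le> - x (h k t)" if "k \<in> {1..m}" "p \<le> t" "t \<le> q" for k t
    using bound[OF that] by auto
  then have "x q - x p \<le> A * (B q - B p)" "- x q - - x p \<le> A * (B q - B p)"
    by (intro solution_increment_le[OF x s] solution_increment_le[OF solves_uminus[OF x] s]; simp)+
  then show ?thesis by (simp add: abs_le_iff)
qed

end

section \<open>The overshoot after a zero\<close>

context delay_equation
begin

text \<open>Here \<open>d k\<close> is a delay in the time \<open>B\<close> and \<open>w k\<close> a
  past value of \<open>z\<close>. For the first line \<open>0 \<le> w k\<close> suffices. Otherwise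
  the lower bound on \<open>w k\<close> is affine in \<open>d k\<close>, so its weighted mean
  involves only the mean delay, and \<open>active_slope_bound\<close> applies with
  \<open>T' + \<eta>\<close> in place of the delay.\<close>

lemma overshoot_slope:
  assumes lam: "22 \<le> lam"
    and piece: "(p, q, \<alpha>) \<in> set (pieces lam)" "polygon lam z = line (p, q, \<alpha>) z"
    and a: "\<And>k. k \<in> {1..m} \<Longrightarrow> 0 \<le> a k t" and \<eta>: "T' + \<eta> \<le> 13679/10000"
    and mean: "(\<Sum>k=1..m. a k t * d k) \<le> T' * (\<Sum>k=1..m. a k t)"
    and w: "\<And>k. k \<in> {1..m} \<Longrightarrow> 0 \<le> w k"
      "\<And>k. k \<in> {1..m} \<Longrightarrow> 1 \<le> z \<Longrightarrow> z * (1 - (d k + \<eta>) / polygon lam z) \<le> w k"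
  shows "\<alpha> * (\<Sum>k=1..m. a k t * (1 - w k)) \<le> (\<Sum>k=1..m. a k t)"
proof (cases "\<alpha> = 1")
  case True
  have "(\<Sum>k=1..m. a k t * (1 - w k)) \<le> (\<Sum>k=1..m. a k t)"
    using a w(1) by (intro sum_mono) (simp add: mult_left_le)
  with True show ?thesis by simp
next
  case False
  define S where "S = (\<Sum>k=1..m. a k t)"
  define r where "r = z / polygon lam z"
  have S: "0 \<le> S" unfolding S_def using a by (intro sum_nonneg) auto
  have z: "1 \<le> z" and slope: "\<alpha> * (1 - z + z * (13679/10000) / polygon lam z) \<le> 1"
    using active_slope_bound[OF piece(1) lam piece(2) False] by auto
  have \<alpha>: "0 \<le> \<alpha>" using pieces_slope[OF piece(1) lam] by simp
  have "0 < polygon lam z" using polygon_ge[of z lam] z by linarith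
  then have r: "0 \<le> r" using z by (simp add: r_def)
  have "(\<Sum>k=1..m. a k t * (1 - w k)) \<le> (\<Sum>k=1..m. a k t * (1 - z + r * (d k + \<eta>)))"
  proof (intro sum_mono mult_left_mono)
    fix k assume k: "k \<in> {1..m}"
    have "z - r * (d k + \<eta>) \<le> w k" using w(2)[OF k z] by (simp add: r_def right_diff_distrib)
    then show "1 - w k \<le> 1 - z + r * (d k + \<eta>)" by simp
  qed (use a in auto)
  also have "\<dots> = (1 - z) * S + r * ((\<Sum>k=1..m. a k t * d k) + \<eta> * S)"
    by (simp add: S_def algebra_simps sum.distrib sum_distrib_left sum_subtractf)
  also have "\<dots> \<le> (1 - z) * S + r * (T' * S + \<eta> * S)"
    using mean r by (intro add_left_mono mult_left_mono) (auto simp: S_def)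
  also have "\<dots> = (1 - z) * S + r * S * (T' + \<eta>)" by (simp add: algebra_simps)
  also have "\<dots> \<le> (1 - z) * S + r * S * (13679/10000)"
    using \<eta> r S by (intro add_left_mono mult_left_mono) auto
  also have "\<dots> = (1 - z + z * (13679/10000) / polygon lam z) * S" by (simp add: r_def algebra_simps)
  finally have "\<alpha> * (\<Sum>k=1..m. a k t * (1 - w k)) \<le> \<alpha> * ((1 - z + z * (13679/10000) / polygon lam z) * S)"
    using \<alpha> by (rule mult_left_mono)
  also have "\<dots> \<le> 1 * S" unfolding mult.assoc[symmetric] using slope S by (rule mult_right_mono)
  finally show ?thesis by (simp add: S_def)
qed

text \<open>The difference of \<open>B\<close> and the polygon along the solution is nondecreasing: wherever it is close to its running maximum, the past of the
  solution satisfies the hypothesis of \<open>overshoot_slope\<close>, by the star-shape of the polygon.\<close>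

lemma overshoot_polygon:
  assumes x: "solves m a h s x" and s: "0 \<le> s" "s \<le> s0" "ts \<le> s0" "s0 \<le> r"
    and v0: "0 \<le> v0" "v0 \<le> s0" and hist: "\<And>k t. k \<in> {1..m} \<Longrightarrow> s0 \<le> t \<Longrightarrow> t \<le> r \<Longrightarrow> v0 \<le> h k t"
    and bound: "\<And>v. v0 \<le> v \<Longrightarrow> v \<le> r \<Longrightarrow> \<bar>x v\<bar> \<le> 1"
    and zero: "x s0 = 0" and rise: "\<And>v. v0 \<le> v \<Longrightarrow> v \<le> s0 \<Longrightarrow> - (B s0 - B v) \<le> x v"
    and lam: "22 \<le> lam"
  shows "polygon lam (1 + x r) \<le> B r - B s0 + 1"
proof -
  define c where "c t = B t - polygon lam (1 + x t)" for t
  \<comment> \<open>The slack in the mean delay is spent as the tolerance for being close to the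
    running maximum.\<close>
  define \<eta> where "\<eta> = 13679/10000 - T'"
  have \<eta>: "0 < \<eta>" using T' by (simp add: \<eta>_def)
  have h_le_r: "h k t \<le> t" "v0 \<le> h k t" if "k \<in> {1..m}" "s0 \<le> t" "t \<le> r" for k t
    using h_le[of k t] hist that v0 by auto
  have x_inc: "\<bar>x v - x u\<bar> \<le> B v - B u" if "s0 \<le> u" "u \<le> v" "v \<le> r" for u v
  proof -
    have "\<bar>x v - x u\<bar> \<le> 1 * (B v - B u)"
    proof (rule solution_increment_abs_le[OF x])
      fix k t assume kt: "k \<in> {1..m}" "u \<le> t" "t \<le> v"
      then show "\<bar>x (h k t)\<bar> \<le> 1" using h_le_r[of k t] that by (intro bound) auto
    qed (use s that in auto)
    then show ?thesis by simp
  qed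
  have c_lip: "\<bar>c v - c u\<bar> \<le> ((1 + lam) * C) * (v - u)" if "s0 \<le> u" "u \<le> v" "v \<le> r" for u v
  proof -
    have "\<bar>polygon lam (1 + x v) - polygon lam (1 + x u)\<bar> \<le> lam * \<bar>x v - x u\<bar>"
      using polygon_lipschitz[OF lam, of "1 + x v" "1 + x u"] by simp
    also have "\<dots> \<le> lam * (B v - B u)" using x_inc[OF that] lam by (intro mult_left_mono) auto
    finally have "\<bar>c v - c u\<bar> \<le> (1 + lam) * (B v - B u)"
      using B_mono[of u v] that s v0 by (simp add: c_def algebra_simps)
    also have "\<dots> \<le> (1 + lam) * (C * (v - u))"
      using B_lipschitz[of u v] lam that s v0 by (intro mult_left_mono) auto
    finally show ?thesis by (simp add: mult.assoc)
  qed
  have c_ac: "abs_continuous_on_interval p q c" if "s0 \<le> p" "q \<le> r" for p q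
    using c_lip that by (intro abs_continuous_lipschitz[where C = "(1 + lam) * C"]) auto
  have "c s0 \<le> c r"
  proof (rule running_max_imp_le[OF _ \<open>s0 \<le> r\<close> \<eta>])
    show "continuous_on {s0..r} c" by (intro abs_continuous_imp_continuous_on c_ac) auto
    fix p q assume pq: "s0 \<le> p" "p \<le> q" "q \<le> r"
      and run: "\<And>t v. p \<le> t \<Longrightarrow> t \<le> q \<Longrightarrow> s0 \<le> v \<Longrightarrow> v \<le> t \<Longrightarrow> c v < c t + \<eta>"
    \<comment> \<open>After \<open>s0\<close> this is closeness to the running maximum. Before
      \<open>s0\<close> it follows from \<open>rise\<close> and from the lag at \<open>s0\<close>,
      where the polygon is at most \<open>1\<close>.\<close>
    have past: "polygon lam (1 + x t) - (B t - B v) - \<eta> \<le> polygon lam (1 + x v)"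
      if t: "p \<le> t" "t \<le> q" and v: "v0 \<le> v" "v \<le> t" for t v
    proof (cases "s0 \<le> v")
      case True
      then show ?thesis using run[of t v] t v by (simp add: c_def)
    next
      case False
      then have "1 - (B s0 - B v) \<le> 1 + x v" using rise[of v] v by simp
      also have "\<dots> \<le> polygon lam (1 + x v)" by (rule polygon_ge)
      finally have "1 - (B s0 - B v) \<le> polygon lam (1 + x v)" .
      moreover have "c s0 < c t + \<eta>" using run[of t s0] t pq by simp
      then have "polygon lam (1 + x t) < 1 - B s0 + B t + \<eta>"
        using polygon_1[OF lam] zero by (simp add: c_def)
      ultimately show ?thesis by linarith
    qed
    show "c p \<le> c q"
    proof (rule abs_continuous_mono_dini[where f = c])
      show "abs_continuous_on_interval p q c" using pq by (intro c_ac)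
      show "AE t in lebesgue. p \<le> t \<and> t \<le> q \<longrightarrow>
        (\<forall>\<epsilon>>0. \<exists>\<delta>>0. \<forall>u v. p \<le> u \<and> u \<le> t \<and> t \<le> v \<and> v \<le> q \<and> v - u < \<delta> \<longrightarrow>
          - \<epsilon> * (v - u) \<le> c v - c u)"
        using B_deriv mean_delay x[unfolded solves_def, THEN conjunct2]
      proof (eventually_elim, intro impI allI)
        fix t \<epsilon> :: real
        assume *: "0 \<le> t \<longrightarrow> (B has_real_derivative (\<Sum>k=1..m. a k t)) (at t) \<and> (\<forall>k\<in>{1..m}. 0 \<le> a k t)"
          "ts \<le> t \<longrightarrow> (\<Sum>k=1..m. a k t * (B t - B (h k t))) \<le> T' * (\<Sum>k=1..m. a k t)"
          "s \<le> t \<longrightarrow> (x has_real_derivative - (\<Sum>k=1..m. a k t * x (h k t))) (at t)"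
          and t: "p \<le> t \<and> t \<le> q" and "\<epsilon> > 0"
        have tt: "0 \<le> t" "ts \<le> t" "s \<le> t" "s0 \<le> t" "t \<le> r" using t pq s v0 by auto
        let ?x' = "- (\<Sum>k=1..m. a k t * x (h k t))"
        let ?z = "1 + x t" and ?w = "\<lambda>k. 1 + x (h k t)" and ?d = "\<lambda>k. B t - B (h k t)"
        have dz: "((\<lambda>t. 1 + x t) has_real_derivative ?x') (at t)"
          using *(3) tt by (auto intro!: derivative_eq_intros)
        have x'_eq: "?x' = (\<Sum>k=1..m. a k t * (1 - ?w k))" by (simp add: sum_negf)
        have w0: "0 \<le> ?w k" if k: "k \<in> {1..m}" for k
          using bound[of "h k t"] h_le_r[OF k tt(4,5)] tt by (auto simp: abs_le_iff)
        have w1: "?z * (1 - (?d k + \<eta>) / polygon lam ?z) \<le> ?w k" if k: "k \<in> {1..m}" and z: "1 \<le> ?z" for k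
        proof -
          have V: "0 < polygon lam ?z" using polygon_ge[of ?z lam] z by linarith
          have d0: "0 \<le> ?d k" using B_mono[of "h k t" t] h_le_r[OF k tt(4,5)] v0 by simp
          show ?thesis
          \<comment> \<open>Star-shapedness compares \<open>?w k\<close> with a larger
            \<open>?z\<close>; otherwise the past value exceeds the chord trivially.\<close>
          proof (cases "?z \<le> ?w k")
            case True
            have "?z * (1 - (?d k + \<eta>) / polygon lam ?z) \<le> ?z * 1"
              using z V d0 \<eta> by (intro mult_left_mono) auto
            also have "\<dots> \<le> ?w k" using True by simp
            finally show ?thesis .
          next
            case False
            have "polygon lam ?z - ?d k - \<eta> \<le> polygon lam (?w k)"
              using past[of t "h k t"] t h_le_r[OF k tt(4,5)] by simp
            also have "\<dots> \<le> ?w k / ?z * polygon lam ?z"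
              using False z w0[OF k] by (intro polygon_star[OF lam]) auto
            finally have "(polygon lam ?z - ?d k - \<eta>) / polygon lam ?z \<le> ?w k / ?z"
              using V by (simp add: pos_divide_le_eq)
            then have "?z * ((polygon lam ?z - ?d k - \<eta>) / polygon lam ?z) \<le> ?w k"
              using z by (simp add: pos_le_divide_eq mult.commute)
            also have "(polygon lam ?z - ?d k - \<eta>) / polygon lam ?z = 1 - (?d k + \<eta>) / polygon lam ?z"
              using V by (simp add: diff_divide_distrib add_divide_distrib)
            finally show ?thesis .
          qed
        qed
        have "\<exists>\<delta>>0. \<forall>u v. u \<le> t \<and> t \<le> v \<and> v - u < \<delta> \<longrightarrow>
          - \<epsilon> * (v - u) \<le> (B v - polygon lam (1 + x v)) - (B u - polygon lam (1 + x u))"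
        proof (rule minus_polygon_dini[where z = "\<lambda>t. 1 + x t", OF _ dz _ \<open>\<epsilon> > 0\<close>])
          show "(B has_real_derivative (\<Sum>k=1..m. a k t)) (at t)" using * tt by blast
          fix p q \<alpha> assume l: "(p, q, \<alpha>) \<in> set (pieces lam)" "polygon lam ?z = line (p, q, \<alpha>) ?z"
          show "\<alpha> * ?x' \<le> (\<Sum>k=1..m. a k t)"
            unfolding x'_eq
          proof (rule overshoot_slope[OF lam l, where d = ?d and \<eta> = \<eta>])
            show "(\<Sum>k=1..m. a k t * ?d k) \<le> T' * (\<Sum>k=1..m. a k t)" using * tt by blast
          qed (use * tt w0 w1 in \<open>auto simp: \<eta>_def\<close>)
        qed
        then show "\<exists>\<delta>>0. \<forall>u v. p \<le> u \<and> u \<le> t \<and> t \<le> v \<and> v \<le> q \<and> v - u < \<delta> \<longrightarrow>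
          - \<epsilon> * (v - u) \<le> c v - c u" unfolding c_def by blast
      qed
    qed fact
  qed
  then show ?thesis using polygon_1[OF lam] zero by (simp add: c_def)
qed

text \<open>Above \<open>1999/1000\<close> the last line may be arbitrarily steep, whereas the
  polygon along the solution is at most the elapsed time plus \<open>1\<close>. So that height is a
  barrier for \<open>1 + x\<close>.\<close>

lemma overshoot_unit:
  assumes x: "solves m a h s x" and s: "0 \<le> s" "s \<le> s0" "ts \<le> s0" "s0 \<le> r"
    and v0: "0 \<le> v0" "v0 \<le> s0" and hist: "\<And>k t. k \<in> {1..m} \<Longrightarrow> s0 \<le> t \<Longrightarrow> t \<le> r \<Longrightarrow> v0 \<le> h k t"
    and bound: "\<And>v. v0 \<le> v \<Longrightarrow> v \<le> r \<Longrightarrow> \<bar>x v\<bar> \<le> 1"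
    and zero: "x s0 = 0" and rise: "\<And>v. v0 \<le> v \<Longrightarrow> v \<le> s0 \<Longrightarrow> - (B s0 - B v) \<le> x v"
  shows "x r \<le> 999/1000"
proof (rule ccontr)
  assume "\<not> x r \<le> 999/1000"
  define w where "w = 1 + x r - 1999/1000"
  have w: "w > 0" using \<open>\<not> x r \<le> 999/1000\<close> by (simp add: w_def)
  \<comment> \<open>Steep enough that the last line alone exceeds the elapsed time plus
    \<open>1\<close> at the supposed excess \<open>w\<close>.\<close>
  define lam where "lam = max 22 ((B r - B s0 + 1) / w)"
  have "2748/1000 + lam * w \<le> polygon lam (1 + x r)" unfolding w_def by (rule polygon_last)
  also have "\<dots> \<le> B r - B s0 + 1"
    using overshoot_polygon[OF x s v0 hist bound zero rise, of lam] by (simp add: lam_def)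
  also have "\<dots> = (B r - B s0 + 1) / w * w" using w by simp
  also have "\<dots> \<le> lam * w" using w by (intro mult_right_mono) (auto simp: lam_def)
  finally show False by simp
qed

end

lemma first_hit:
  fixes f :: "real \<Rightarrow> real"
  assumes cont: "continuous_on {p..q} f" and "p \<le> q" "f p < c" "c < f q"
  obtains r where "p \<le> r" "r \<le> q" "f r = c" "\<And>v. p \<le> v \<Longrightarrow> v \<le> r \<Longrightarrow> f v \<le> c"
proof -
  define S where "S = {t \<in> {p..q}. c \<le> f t}"
  have "closed S" unfolding S_def
    by (intro continuous_on_closed_Collect_le cont continuous_on_const) auto
  moreover have "q \<in> S" using assms by (auto simp: S_def)
  moreover have bb: "bdd_below S" by (auto simp: S_def intro: bdd_belowI[of _ p])
  ultimately have "Inf S \<in> S" by (intro closed_contains_Inf) auto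
  define r where "r = Inf S"
  have r: "p \<le> r" "r \<le> q" "c \<le> f r" using \<open>Inf S \<in> S\<close> by (auto simp: S_def r_def)
  have least: "r \<le> t" if "p \<le> t" "t \<le> q" "c \<le> f t" for t
    unfolding r_def using bb that by (intro cInf_lower) (auto simp: S_def)
  have "\<exists>t\<ge>p. t \<le> r \<and> f t = c"
    using r assms by (intro IVT') (auto intro: continuous_on_subset[OF cont])
  then have "f r = c" using least r by (metis order.antisym order.trans order_refl)
  moreover have "f v \<le> c" if "p \<le> v" "v \<le> r" for v
    using least[of v] that r \<open>f r = c\<close> by (cases "c \<le> f v") auto
  ultimately show thesis using that r by blast
qed

section \<open>Contraction of the amplitude and geometric decay after \<open>ts\<close>\<close>

context delay_equation
begin

lemma h_ge:
  assumes "k \<in> {1..m}" "ts \<le> t" "0 \<le> p" "B p + D < B t"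
  shows "p \<le> h k t"
proof (rule ccontr)
  assume "\<not> p \<le> h k t"
  then have "B (h k t) \<le> B p" using delay_bounded[OF assms(1,2)] by (intro B_mono) auto
  then show False using delay_bounded[OF assms(1,2)] assms(4) by simp
qed

lemma B_less_imp_le: "0 \<le> t \<Longrightarrow> B s < B t \<Longrightarrow> s \<le> t"
  by (rule ccontr) (use B_mono[of t s] in auto)

text \<open>Scaling by \<open>1 / A\<close> and by \<open>- 1 / A\<close> reduces both signs to the
  one-sided unit case.\<close>

lemma overshoot:
  assumes x: "solves m a h s x" and s: "0 \<le> s" "s \<le> s0" "ts \<le> s0" "s0 \<le> r"
    and v0: "0 \<le> v0" "v0 \<le> s0" and hist: "\<And>k t. k \<in> {1..m} \<Longrightarrow> s0 \<le> t \<Longrightarrow> t \<le> r \<Longrightarrow> v0 \<le> h k t"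
    and bound: "\<And>v. v0 \<le> v \<Longrightarrow> v \<le> r \<Longrightarrow> \<bar>x v\<bar> \<le> A" and "0 < A"
    and zero: "x s0 = 0" and rise: "\<And>v. v0 \<le> v \<Longrightarrow> v \<le> s0 \<Longrightarrow> \<bar>x v\<bar> \<le> A * (B s0 - B v)"
  shows "\<bar>x r\<bar> \<le> 999/1000 * A"
proof -
  have "c * x r \<le> 999/1000" if c: "\<bar>c\<bar> = 1 / A" for c
  proof (rule overshoot_unit[OF solves_scale[OF x] s v0 hist])
    fix v
    show "\<bar>c * x v\<bar> \<le> 1" if "v0 \<le> v" "v \<le> r"
      using bound[OF that] c \<open>0 < A\<close> by (simp add: abs_mult)
    show "- (B s0 - B v) \<le> c * x v" if "v0 \<le> v" "v \<le> s0"
    proof -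
      have "\<bar>c * x v\<bar> \<le> B s0 - B v"
        using rise[OF that] c \<open>0 < A\<close> by (simp add: abs_mult pos_divide_le_eq mult.commute)
      then show ?thesis by (simp add: abs_le_iff)
    qed
  qed (use zero in auto)
  from this[of "1 / A"] this[of "- 1 / A"] \<open>0 < A\<close> show ?thesis
    by (simp add: abs_le_iff pos_divide_le_eq field_simps)
qed

text \<open>Two generations of history are required before the zero: delays after \<open>s0\<close>
  reach back to \<open>v0\<close> at most, and the slope bound on \<open>[v0, s0]\<close> uses
  values back to \<open>s1\<close>.\<close>

lemma contraction_after_zero:
  assumes x: "solves m a h s x" and s: "s \<le> s1" "ts \<le> s1" "0 \<le> s" "s1 \<le> r"
    and bound: "\<And>v. s1 \<le> v \<Longrightarrow> v \<le> r \<Longrightarrow> \<bar>x v\<bar> \<le> A" and "0 < A"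
    and zero: "x s0 = 0" "s1 \<le> s0" "B s1 + 3 * D \<le> B s0" "s0 \<le> r"
  shows "\<bar>x r\<bar> \<le> 999/1000 * A"
proof -
  \<comment> \<open>The midpoint of the \<open>3 * D\<close> available, so that both generations are
    longer than \<open>D\<close>, as \<open>h_ge\<close> demands strictly.\<close>
  have "\<exists>t\<ge>s1. B t = B s1 + 3/2 * D" by (rule B_reaches) (use s ts D in auto)
  then obtain v0 where v0: "s1 \<le> v0" "B v0 = B s1 + 3/2 * D" by blast
  have v0s0: "v0 \<le> s0" by (rule B_less_imp_le) (use v0 zero D s in linarith)+
  show ?thesis
  proof (rule overshoot[OF x])
    fix k t assume kt: "k \<in> {1..m}" "s0 \<le> t" "t \<le> r"
    have "B s0 \<le> B t" using kt zero s ts by (intro B_mono) auto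
    then show "v0 \<le> h k t" using kt zero s ts v0 D by (intro h_ge) auto
  next
    fix v assume v: "v0 \<le> v" "v \<le> s0"
    have "\<bar>x s0 - x v\<bar> \<le> A * (B s0 - B v)"
    proof (rule solution_increment_abs_le[OF x])
      fix k t assume kt: "k \<in> {1..m}" "v \<le> t" "t \<le> s0"
      have "B v0 \<le> B t" using kt v v0 s ts by (intro B_mono) auto
      then have "s1 \<le> h k t" using kt v v0 s ts D by (intro h_ge) auto
      moreover have "h k t \<le> t" using kt v v0 s ts by (intro h_le) auto
      ultimately show "\<bar>x (h k t)\<bar> \<le> A" using kt zero by (intro bound) auto
    qed (use v v0 s in auto)
    then show "\<bar>x v\<bar> \<le> A * (B s0 - B v)" using zero by simp
  qed (use s v0 v0s0 zero \<open>0 < A\<close> bound in auto)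
qed

text \<open>The sign is constant on \<open>[p, v]\<close>, and from \<open>u\<close> on the delayed
  arguments stay in that interval; hence the feedback pulls towards zero with strength at least
  \<open>\<beta>\<close>. It is used with \<open>\<beta> = 0\<close> for monotonicity and with
  \<open>\<beta> = \<bar>x v\<bar>\<close> for a real gain.\<close>

lemma nonvanishing_decrease:
  assumes x: "solves m a h s x" and s: "0 \<le> s" "s \<le> p" "p \<le> u" "u \<le> v" "ts \<le> u"
    and nz: "\<And>w. p \<le> w \<Longrightarrow> w \<le> v \<Longrightarrow> x w \<noteq> 0"
    and \<beta>: "\<And>w. p \<le> w \<Longrightarrow> w \<le> v \<Longrightarrow> \<beta> \<le> \<bar>x w\<bar>" and B: "B p + D < B u"
  shows "\<bar>x v\<bar> + \<beta> * (B v - B u) \<le> \<bar>x u\<bar>"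
proof -
  have pos_case: "\<bar>y v\<bar> + \<beta> * (B v - B u) \<le> \<bar>y u\<bar>"
    if y: "solves m a h s y" and ypos: "\<And>w. p \<le> w \<Longrightarrow> w \<le> v \<Longrightarrow> 0 < y w" "\<And>w. \<bar>y w\<bar> = \<bar>x w\<bar>" for y
  proof -
    have "y v - y u \<le> (- \<beta>) * (B v - B u)"
    proof (rule solution_increment_le[OF y])
      fix k t assume kt: "k \<in> {1..m}" "u \<le> t" "t \<le> v"
      have "B u \<le> B t" using kt s by (intro B_mono) auto
      then have "p \<le> h k t" using kt s B by (intro h_ge) auto
      moreover have "h k t \<le> t" using kt s by (intro h_le) auto
      ultimately show "- (- \<beta>) \<le> y (h k t)"
        using \<beta>[of "h k t"] ypos(1)[of "h k t"] ypos(2)[of "h k t"] kt by auto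
    qed (use s in auto)
    then show ?thesis using ypos(1)[of v] ypos(1)[of u] s by simp
  qed
  have cont: "continuous_on {p..v} x"
    by (rule continuous_on_subset[OF solves_continuous[OF x]]) (use s in auto)
  have "(\<forall>w\<in>{p..v}. 0 < x w) \<or> (\<forall>w\<in>{p..v}. 0 < - x w)"
  proof (rule ccontr)
    assume "\<not> ?thesis"
    then obtain w1 w2 where w: "w1 \<in> {p..v}" "w2 \<in> {p..v}" "x w1 \<le> 0" "0 \<le> x w2" by force
    have "connected (x ` {p..v})" by (rule connected_continuous_image[OF cont connected_Icc])
    then have "0 \<in> x ` {p..v}"
      by (rule connectedD_interval[where x = "x w1" and y = "x w2"]) (use w in auto)
    then show False using nz by force
  qed
  then show ?thesis
  proof
    assume "\<forall>w\<in>{p..v}. 0 < x w"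
    then show ?thesis by (intro pos_case x) auto
  next
    assume "\<forall>w\<in>{p..v}. 0 < - x w"
    then have "\<bar>- x v\<bar> + \<beta> * (B v - B u) \<le> \<bar>- x u\<bar>"
      by (intro pos_case[where y = "\<lambda>t. - x t"] solves_uminus[OF x]) auto
    then show ?thesis by simp
  qed
qed

text \<open>At the first time \<open>r\<close> of exceeding the bound there is either a zero in the
  recent past, and \<open>contraction_after_zero\<close> keeps the value strictly lower, or none,
  and the modulus has not grown since \<open>s2\<close>.\<close>

lemma bounded_window_imp_bounded:
  assumes x: "solves m a h s x" and s: "s \<le> s1" "ts \<le> s1" "0 \<le> s" "s1 \<le> s2"
    and B: "B s1 + 5 * D \<le> B s2"
    and bound: "\<And>v. s1 \<le> v \<Longrightarrow> v \<le> s2 \<Longrightarrow> \<bar>x v\<bar> \<le> A" and t: "s1 \<le> t"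
  shows "\<bar>x t\<bar> \<le> A"
proof (rule ccontr)
  assume "\<not> \<bar>x t\<bar> \<le> A"
  \<comment> \<open>A level strictly above \<open>A\<close> is positive even for
    \<open>A = 0\<close>, and the modulus at \<open>s2\<close> lies strictly below it.\<close>
  define c where "c = (A + \<bar>x t\<bar>) / 2"
  have "0 \<le> A" using bound[of s1] s by linarith
  then have c: "A < c" "c < \<bar>x t\<bar>" "0 < c" using \<open>\<not> \<bar>x t\<bar> \<le> A\<close> by (auto simp: c_def)
  have "s2 \<le> t" using bound[of t] t \<open>\<not> \<bar>x t\<bar> \<le> A\<close> by linarith
  have cont: "continuous_on {s2..t} (\<lambda>t. \<bar>x t\<bar>)"
    by (intro continuous_on_rabs continuous_on_subset[OF solves_continuous[OF x]]) (use s in auto)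
  have "\<bar>x s2\<bar> < c" using bound[of s2] s c by linarith
  from first_hit[OF cont \<open>s2 \<le> t\<close> this c(2)] obtain r where r: "s2 \<le> r" "r \<le> t" "\<bar>x r\<bar> = c"
    "\<And>v. s2 \<le> v \<Longrightarrow> v \<le> r \<Longrightarrow> \<bar>x v\<bar> \<le> c" by blast
  have rb: "\<bar>x v\<bar> \<le> c" if "s1 \<le> v" "v \<le> r" for v
    using bound[of v] r(4)[of v] that c by (cases "v \<le> s2") auto
  \<comment> \<open>Zeros after \<open>s3\<close> have the history required for contraction; the
    remaining \<open>2 * D\<close> up to \<open>s2\<close> exceed one delay, as needed if there is
    no zero.\<close>
  have "\<exists>t\<ge>s1. B t = B s1 + 3 * D" by (rule B_reaches) (use s ts D in auto)
  then obtain s3 where s3: "s1 \<le> s3" "B s3 = B s1 + 3 * D" by blast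
  have s32: "s3 \<le> s2" by (rule B_less_imp_le) (use s3 B D s ts in linarith)+
  show False
  proof (cases "\<exists>s0\<in>{s3..r}. x s0 = 0")
    case True
    then obtain s0 where s0: "s3 \<le> s0" "s0 \<le> r" "x s0 = 0" by auto
    have "B s3 \<le> B s0" using s0 s3 s ts by (intro B_mono) auto
    then have "\<bar>x r\<bar> \<le> 999/1000 * c"
      using s0 s3 s32 s r rb c by (intro contraction_after_zero[OF x, of s1 r c s0]) auto
    then show False using r c by simp
  next
    case False
    then have "\<bar>x r\<bar> + 0 * (B r - B s2) \<le> \<bar>x s2\<bar>"
      using s s3 s32 r B D by (intro nonvanishing_decrease[OF x, of s3 s2 r 0]) auto
    then show False using r \<open>\<bar>x s2\<bar> < c\<close> by simp
  qed
qed

text \<open>With a zero the overshoot bound applies. Without one, the modulus is nonincreasing after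
  two steps of history, so over a further unit of \<open>B\<close> it loses at least its final
  value, and at most \<open>A / 2\<close> remains.\<close>

lemma contraction:
  assumes x: "solves m a h s x" and s: "s \<le> s1" "ts \<le> s1" "0 \<le> s" "s1 \<le> t"
    and B: "B s1 + (9 * D + 1) \<le> B t"
    and bound: "\<And>v. s1 \<le> v \<Longrightarrow> \<bar>x v\<bar> \<le> A"
  shows "\<bar>x t\<bar> \<le> 999/1000 * A"
proof (cases "A = 0")
  case True
  then show ?thesis using bound[OF s(4)] by simp
next
  case False
  then have A: "0 < A" using bound[of s1] by linarith
  \<comment> \<open>The length \<open>9 * D + 1\<close>: \<open>3 * D\<close> of history for a zero,
    \<open>2 * D\<close> until the modulus is monotone from \<open>s5\<close> on,
    \<open>2 * D\<close> until the delayed arguments have passed \<open>s5\<close>, and at least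
    \<open>1\<close> for the loss.\<close>
  have "\<exists>t\<ge>s1. B t = B s1 + 3 * D" by (rule B_reaches) (use s ts D in auto)
  then obtain s3 where s3: "s1 \<le> s3" "B s3 = B s1 + 3 * D" by blast
  have "\<exists>t\<ge>s3. B t = B s3 + 2 * D" by (rule B_reaches) (use s s3 ts D in auto)
  then obtain s5 where s5: "s3 \<le> s5" "B s5 = B s3 + 2 * D" by blast
  have "\<exists>t\<ge>s5. B t = B s5 + 2 * D" by (rule B_reaches) (use s s3 s5 ts D in auto)
  then obtain s7 where s7: "s5 \<le> s7" "B s7 = B s5 + 2 * D" by blast
  have s7t: "s7 \<le> t" by (rule B_less_imp_le) (use s3 s5 s7 B D s ts in linarith)+
  show ?thesis
  proof (cases "\<exists>s0\<in>{s3..t}. x s0 = 0")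
    case True
    then obtain s0 where s0: "s3 \<le> s0" "s0 \<le> t" "x s0 = 0" by auto
    have "B s3 \<le> B s0" using s0 s3 s ts by (intro B_mono) auto
    then show ?thesis using s0 s3 s A bound by (intro contraction_after_zero[OF x, of s1 t A s0]) auto
  next
    case False
    have mono: "\<bar>x t\<bar> \<le> \<bar>x w\<bar>" if w: "s5 \<le> w" "w \<le> t" for w
    proof -
      have "B s5 \<le> B w" using w s3 s5 s ts by (intro B_mono) auto
      then have "\<bar>x t\<bar> + 0 * (B t - B w) \<le> \<bar>x w\<bar>"
        using w s s3 s5 D False by (intro nonvanishing_decrease[OF x, of s3 w t 0]) auto
      then show ?thesis by simp
    qed
    have "\<bar>x t\<bar> + \<bar>x t\<bar> * (B t - B s7) \<le> \<bar>x s7\<bar>"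
      using s s3 s5 s7 s7t D False mono by (intro nonvanishing_decrease[OF x, of s5 s7 t]) auto
    moreover have "\<bar>x t\<bar> * 1 \<le> \<bar>x t\<bar> * (B t - B s7)"
      using s3 s5 s7 B D by (intro mult_left_mono) auto
    moreover have "\<bar>x s7\<bar> \<le> A" using s3 s5 s7 by (intro bound) auto
    ultimately show ?thesis using A by linarith
  qed
qed

lemma geometric_decay:
  assumes x: "solves m a h s x" and s: "s \<le> s1" "ts \<le> s1" "0 \<le> s"
    and bound: "\<And>v. s1 \<le> v \<Longrightarrow> \<bar>x v\<bar> \<le> A"
  shows "s1 \<le> t \<Longrightarrow> B s1 + real n * (9 * D + 1) \<le> B t \<Longrightarrow> \<bar>x t\<bar> \<le> (999/1000) ^ n * A"
proof (induction n arbitrary: t)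
  case 0
  then show ?case using bound by simp
next
  case (Suc n)
  have P: "0 < 9 * D + 1" using D by simp
  have "\<exists>t\<ge>s1. B t = B s1 + real n * (9 * D + 1)" by (rule B_reaches) (use s ts P in auto)
  then obtain s' where s': "s1 \<le> s'" "B s' = B s1 + real n * (9 * D + 1)" by blast
  have Bt: "B s' + (9 * D + 1) \<le> B t" using Suc.prems s' by (simp add: algebra_simps)
  have "s' \<le> t" by (rule B_less_imp_le) (use Bt P s ts Suc.prems in linarith)+
  have "\<bar>x t\<bar> \<le> 999/1000 * ((999/1000) ^ n * A)"
  proof (rule contraction[OF x _ _ _ \<open>s' \<le> t\<close> Bt])
    fix v assume v: "s' \<le> v"
    have "B s' \<le> B v" using v s' s ts by (intro B_mono) auto
    then show "\<bar>x v\<bar> \<le> (999/1000) ^ n * A" using v s' by (intro Suc.IH) auto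
  qed (use s s' in auto)
  then show ?case by simp
qed

text \<open>The exponent for which \<open>9 * D + 1\<close> units of the time \<open>B\<close> give
  the factor \<open>999/1000\<close>.\<close>

definition rate where "rate = - ln (999/1000) / (9 * D + 1)"

lemma rate_pos: "0 < rate"
  unfolding rate_def using D by (intro divide_pos_pos) (auto simp: ln_less_zero)

text \<open>The factor \<open>1000/999\<close> pays for the incomplete last period, as the number of
  contractions is a rounded-down quotient.\<close>

lemma exponential_decay:
  assumes x: "solves m a h s x" and s: "s \<le> s1" "ts \<le> s1" "0 \<le> s"
    and bound: "\<And>v. s1 \<le> v \<Longrightarrow> \<bar>x v\<bar> \<le> A" and t: "s1 \<le> t"
  shows "\<bar>x t\<bar> \<le> 1000/999 * A * exp (- rate * (B t - B s1))"
proof -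
  define P where "P = 9 * D + 1"
  have P: "0 < P" using D by (simp add: P_def)
  define y where "y = (B t - B s1) / P"
  have y: "0 \<le> y" using B_mono[of s1 t] t s ts P by (simp add: y_def)
  define n where "n = nat \<lfloor>y\<rfloor>"
  have n: "real n \<le> y" "y < real n + 1" using y unfolding n_def by linarith+
  have "real n * P \<le> B t - B s1" using n(1) P by (simp add: y_def pos_le_divide_eq)
  then have "\<bar>x t\<bar> \<le> (999/1000) ^ n * A"
    using t by (intro geometric_decay[OF x s bound]) (auto simp: P_def)
  also have "(999/1000 :: real) ^ n \<le> 1000/999 * exp (- rate * (B t - B s1))"
  proof -
    have L: "ln (999/1000 :: real) < 0" by (simp add: ln_less_zero)
    have "(999/1000 :: real) ^ n = exp (real n * ln (999/1000))" by (simp add: exp_of_nat_mult)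
    also have "\<dots> \<le> exp ((y - 1) * ln (999/1000))"
      using n L by (intro exp_le_cancel_iff[THEN iffD2] mult_right_mono_neg) auto
    also have "(y - 1) * ln (999/1000) = - rate * (B t - B s1) + - ln (999/1000)"
      unfolding rate_def y_def P_def[symmetric] by (simp add: algebra_simps)
    also have "exp (- rate * (B t - B s1) + - ln (999/1000)) = 1000/999 * exp (- rate * (B t - B s1))"
      unfolding exp_add exp_minus[of "ln (999/1000)"] by simp
    finally show ?thesis .
  qed
  then have "(999/1000) ^ n * A \<le> 1000/999 * exp (- rate * (B t - B s1)) * A"
    using bound[OF t] by (intro mult_right_mono) auto
  finally show ?thesis by (simp add: mult_ac)
qed

end

section \<open>Estimates from the initial data, uniform in the initial time\<close>

context delay_equation
begin

lemma exp_B_ac: "0 \<le> p \<Longrightarrow> abs_continuous_on_interval p q (\<lambda>t. exp (B t - c))"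
proof (rule abs_continuous_lipschitz)
  fix u v assume uv: "0 \<le> p" "p \<le> u" "u \<le> v" "v \<le> q"
  have "B u \<le> B v" "B v \<le> B q" using uv by (auto intro!: B_mono)
  have "exp (B v - c) - exp (B u - c) = exp (B v - c) * (1 - exp (- (B v - B u)))"
    by (simp add: right_diff_distrib exp_add[symmetric])
  also have "\<dots> \<le> exp (B q - c) * (B v - B u)"
  proof (rule mult_mono)
    show "1 - exp (- (B v - B u)) \<le> B v - B u"
      using exp_ge_add_one_self[of "- (B v - B u)"] by linarith
  qed (use \<open>B u \<le> B v\<close> \<open>B v \<le> B q\<close> in auto)
  also have "\<dots> \<le> exp (B q - c) * (C * (v - u))" using uv by (intro mult_left_mono B_lipschitz) auto
  finally show "\<bar>exp (B v - c) - exp (B u - c)\<bar> \<le> (exp (B q - c) * C) * (v - u)"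
    using \<open>B u \<le> B v\<close> by (simp add: mult.assoc)
qed

text \<open>A Gronwall estimate that holds from any initial time, also before \<open>ts\<close>: the
  increasing function \<open>c * exp (B t - B s)\<close> with \<open>c > A\<close> dominates all
  past values up to the first contact and therefore grows at least as fast as the solution. With
  \<open>A = 0\<close> it yields uniqueness.\<close>

lemma growth_bound:
  assumes x: "solves m a h s x" and s: "0 \<le> s" and hist: "\<And>v. v \<le> s \<Longrightarrow> \<bar>x v\<bar> \<le> A" and t: "s \<le> t"
  shows "\<bar>x t\<bar> \<le> A * exp (B t - B s)"
proof (rule ccontr)
  assume neg: "\<not> \<bar>x t\<bar> \<le> A * exp (B t - B s)"
  define f where "f t = \<bar>x t\<bar> * exp (- (B t - B s))" for t
  have x_f: "\<bar>x v\<bar> = f v * exp (B v - B s)" for v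
    unfolding f_def mult.assoc exp_add[symmetric] by simp
  have Aft: "A < f t" using neg unfolding x_f by simp
  \<comment> \<open>Strictly above \<open>A\<close>, so that the comparison starts with strict
    inequality, which then contradicts equality at the first contact.\<close>
  define c where "c = (A + f t) / 2"
  have A: "0 \<le> A" using hist[of s] by linarith
  have c: "A < c" "c < f t" using Aft by (auto simp: c_def)
  have "f s < c" using hist[of s] c by (simp add: f_def)
  have cont: "continuous_on {s..t} f" unfolding f_def[abs_def]
    by (intro continuous_intros continuous_on_subset[OF solves_continuous[OF x]]
        continuous_on_subset[OF B_continuous]) (use s in auto)
  obtain r where r: "s \<le> r" "r \<le> t" "f r = c" "\<And>v. s \<le> v \<Longrightarrow> v \<le> r \<Longrightarrow> f v \<le> c"
    using first_hit[OF cont t \<open>f s < c\<close> c(2)] by blast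
  have past: "\<bar>x v\<bar> \<le> c * exp (B u - B s)" if u: "s \<le> u" "u \<le> r" and v: "v \<le> u" for u v
  proof (cases "s \<le> v")
    case True
    then have "f v \<le> c" using r(4)[of v] u v by simp
    then have "\<bar>x v\<bar> \<le> c * exp (B v - B s)" unfolding x_f by (intro mult_right_mono) auto
    also have "\<dots> \<le> c * exp (B u - B s)"
      using c A B_mono[of v u] True v s by (intro mult_left_mono) auto
    finally show ?thesis .
  next
    case False
    then have "\<bar>x v\<bar> \<le> c * 1" using hist[of v] c by simp
    also have "\<dots> \<le> c * exp (B u - B s)"
      using c A B_mono[of s u] u s by (intro mult_left_mono) auto
    finally show ?thesis .
  qed
  have one_sided: "y r < c * exp (B r - B s)"
    if y: "solves m a h s y" and yx: "\<And>v. \<bar>y v\<bar> = \<bar>x v\<bar>" for y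
  proof -
    define g where "g t = c * exp (B t - B s) + - y t" for t
    have "g s \<le> g r"
    proof (rule abs_continuous_deriv_nonneg_imp_le[where c = s and d = r and f = g])
      show "abs_continuous_on_interval s r g" unfolding g_def[abs_def]
        using solves_ac[OF y] s r
        by (intro abs_continuous_add abs_continuous_uminus abs_continuous_cmult exp_B_ac) auto
      show "AE u in lebesgue. s \<le> u \<and> u \<le> r \<longrightarrow> (\<exists>f'\<ge>0. (g has_real_derivative f') (at u))"
        using B_deriv y[unfolded solves_def, THEN conjunct2]
      proof (eventually_elim, intro impI)
        fix u assume *: "0 \<le> u \<longrightarrow> (B has_real_derivative (\<Sum>k=1..m. a k u)) (at u) \<and> (\<forall>k\<in>{1..m}. 0 \<le> a k u)"
          "s \<le> u \<longrightarrow> (y has_real_derivative - (\<Sum>k=1..m. a k u * y (h k u))) (at u)" "s \<le> u \<and> u \<le> r"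
        let ?e = "exp (B u - B s)"
        have dB: "(B has_real_derivative (\<Sum>k=1..m. a k u)) (at u)" using * s by auto
        have dy: "(y has_real_derivative - (\<Sum>k=1..m. a k u * y (h k u))) (at u)" using * by auto
        have "(g has_real_derivative c * (?e * (\<Sum>k=1..m. a k u)) + - (- (\<Sum>k=1..m. a k u * y (h k u)))) (at u)"
          unfolding g_def[abs_def] by (auto intro!: derivative_eq_intros dB dy)
        moreover have "0 \<le> (\<Sum>k=1..m. a k u * (c * ?e + y (h k u)))"
        proof (intro sum_nonneg mult_nonneg_nonneg)
          fix k assume k: "k \<in> {1..m}"
          show "0 \<le> a k u" using * s k by auto
          have "\<bar>y (h k u)\<bar> \<le> c * ?e" unfolding yx using *(3) h_le[OF k, of u] s by (intro past) auto
          then show "0 \<le> c * ?e + y (h k u)" by linarith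
        qed
        then have "0 \<le> c * (?e * (\<Sum>k=1..m. a k u)) + - (- (\<Sum>k=1..m. a k u * y (h k u)))"
          by (simp add: algebra_simps sum.distrib sum_distrib_left)
        ultimately show "\<exists>f'\<ge>0. (g has_real_derivative f') (at u)" by blast
      qed
    qed fact
    moreover have "y s < c" using yx[of s] hist[of s] c by linarith
    ultimately show ?thesis by (simp add: g_def)
  qed
  have "x r < c * exp (B r - B s)" "- x r < c * exp (B r - B s)"
    using one_sided[OF x] one_sided[OF solves_uminus[OF x]] by auto
  then have "\<bar>x r\<bar> < c * exp (B r - B s)" by linarith
  moreover have "\<bar>x r\<bar> = c * exp (B r - B s)" unfolding x_f r(3) ..
  ultimately show False by simp
qed

lemma uniform_decay:
  obtains K where "K > 0"
    "\<And>s x A t. 0 \<le> s \<Longrightarrow> solves m a h s x \<Longrightarrow> (\<And>v. v \<le> s \<Longrightarrow> \<bar>x v\<bar> \<le> A) \<Longrightarrow> s \<le> t \<Longrightarrow>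
      \<bar>x t\<bar> \<le> K * A * exp (- rate * (B t - B s))"
proof -
  \<comment> \<open>\<open>E\<close> bounds the \<open>B\<close>-time from \<open>s\<close> until
    the decay estimate is available: the stretch before \<open>ts\<close>, at most
    \<open>B ts - B 0\<close> for every \<open>s\<close>, and the window of \<open>5 * D\<close>.
    This makes \<open>K\<close> independent of \<open>s\<close>.\<close>
  define E where "E = B ts - B 0 + 5 * D"
  have E: "B ts - B 0 \<le> E" using D by (simp add: E_def)
  define K where "K = 1000/999 * exp E * exp (rate * E)"
  have "K > 0" by (simp add: K_def)
  moreover have "\<bar>x t\<bar> \<le> K * A * exp (- rate * (B t - B s))"
    if s: "0 \<le> s" and x: "solves m a h s x" and hist: "\<And>v. v \<le> s \<Longrightarrow> \<bar>x v\<bar> \<le> A" and t: "s \<le> t" for s x A t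
  proof -
    have A: "0 \<le> A" using hist[of s] by linarith
    define s1 where "s1 = max s ts"
    have s1: "s \<le> s1" "ts \<le> s1" by (auto simp: s1_def)
    have Bs1: "B s1 - B s \<le> B ts - B 0"
      using B_mono[of 0 s] B_mono[of 0 ts] s ts by (auto simp: s1_def max_def)
    have "\<exists>t\<ge>s1. B t = B s1 + 5 * D" by (rule B_reaches) (use s ts s1 D in auto)
    then obtain s2 where s2: "s1 \<le> s2" "B s2 = B s1 + 5 * D" by blast
    have window: "\<bar>x v\<bar> \<le> exp E * A" if v: "s \<le> v" "v \<le> s2" for v
    proof -
      have "\<bar>x v\<bar> \<le> A * exp (B v - B s)" by (rule growth_bound[OF x s hist v(1)])
      also have "\<dots> \<le> A * exp E"
        using B_mono[of v s2] v s s2 Bs1 A by (intro mult_left_mono) (auto simp: E_def)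
      finally show ?thesis by (simp add: mult.commute)
    qed
    show ?thesis
    proof (cases "s1 \<le> t")
      case True
      have "\<bar>x v\<bar> \<le> exp E * A" if v: "s1 \<le> v" for v
        by (rule bounded_window_imp_bounded[OF x, of s1 s2]) (use s s1 s2 window v in auto)
      then have "\<bar>x t\<bar> \<le> 1000/999 * (exp E * A) * exp (- rate * (B t - B s1))"
        by (rule exponential_decay[OF x s1 s _ True])
      also have "exp (- rate * (B t - B s1)) \<le> exp (rate * E) * exp (- rate * (B t - B s))"
      proof -
        have "rate * (B s1 - B s) \<le> rate * E" using rate_pos Bs1 E by (intro mult_left_mono) auto
        then show ?thesis unfolding exp_add[symmetric] by (simp add: algebra_simps)
      qed
      then have "1000/999 * (exp E * A) * exp (- rate * (B t - B s1))
          \<le> 1000/999 * (exp E * A) * (exp (rate * E) * exp (- rate * (B t - B s)))"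
        using A by (intro mult_left_mono) auto
      finally show ?thesis by (simp add: K_def mult_ac)
    next
      case False
      have "B t \<le> B s1" using False t s by (intro B_mono) auto
      then have "rate * (B t - B s) \<le> rate * E" using rate_pos Bs1 E by (intro mult_left_mono) auto
      then have e: "1 \<le> exp (rate * E) * exp (- rate * (B t - B s))"
        unfolding exp_add[symmetric] by simp
      have "\<bar>x t\<bar> \<le> exp E * A" using False t s2 by (intro window) auto
      also have "\<dots> \<le> exp E * A * (1000/999 * (exp (rate * E) * exp (- rate * (B t - B s))))"
      proof -
        have "1 \<le> 1000/999 * (exp (rate * E) * exp (- rate * (B t - B s)))" using e by linarith
        from mult_left_mono[OF this, of "exp E * A"] A show ?thesis by simp
      qed
      finally show ?thesis by (simp add: K_def mult_ac)
    qed
  qed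
  ultimately show thesis by (rule that)
qed

end

section \<open>Existence of the fundamental function\<close>

lemma ess_bounded_set_integrable:
  fixes f :: "real \<Rightarrow> real"
  assumes f: "f \<in> borel_measurable (lebesgue_on {0..})" and "0 \<le> p"
    and bound: "AE t in lebesgue. p \<le> t \<and> t \<le> q \<longrightarrow> \<bar>f t\<bar> \<le> C"
  shows "set_integrable lebesgue {p..q} f"
proof -
  have g: "(\<lambda>t. indicator {0..} t *\<^sub>R f t) \<in> borel_measurable lebesgue"
    using f by (subst (asm) borel_measurable_restrict_space_iff) auto
  have "integrable lebesgue (\<lambda>t. indicator {p..q} t *\<^sub>R (indicator {0..} t *\<^sub>R f t))"
  proof (rule integrableI_bounded_set_indicator[where B = C, OF _ g])
    show "AE t in lebesgue. t \<in> {p..q} \<longrightarrow> norm (indicator {0..} t *\<^sub>R f t) \<le> C"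
      using bound \<open>0 \<le> p\<close> by eventually_elim (auto simp: indicator_def)
  qed (auto simp: emeasure_lborel_Icc_eq)
  also have "(\<lambda>t. indicator {p..q} t *\<^sub>R (indicator {0..} t *\<^sub>R f t)) = (\<lambda>t. indicator {p..q} t *\<^sub>R f t)"
    using \<open>0 \<le> p\<close> by (auto simp: indicator_def fun_eq_iff)
  finally show ?thesis unfolding set_integrable_def .
qed

lemma abs_integral_le_AE:
  fixes f g :: "real \<Rightarrow> real"
  assumes f: "set_integrable lebesgue {p..q} f" and g: "continuous_on {p..q} g"
    and bound: "AE t in lebesgue. p \<le> t \<and> t \<le> q \<longrightarrow> \<bar>f t\<bar> \<le> g t"
  shows "\<bar>integral {p..q} f\<bar> \<le> integral {p..q} g"
proof -
  have g': "set_integrable lebesgue {p..q} g" using absolutely_integrable_continuous_real[OF g] .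
  have "(LINT t:{p..q}|lebesgue. f t) \<le> (LINT t:{p..q}|lebesgue. g t)"
    using f g' unfolding set_lebesgue_integral_def set_integrable_def
    by (rule integral_mono_AE) (use bound in eventually_elim, auto simp: indicator_def)
  moreover have "(LINT t:{p..q}|lebesgue. - g t) \<le> (LINT t:{p..q}|lebesgue. f t)"
    unfolding set_lebesgue_integral_def
  proof (rule integral_mono_AE)
    show "integrable lebesgue (\<lambda>t. indicator {p..q} t *\<^sub>R - g t)"
      using g' unfolding set_integrable_def by simp
    show "integrable lebesgue (\<lambda>t. indicator {p..q} t *\<^sub>R f t)"
      using f unfolding set_integrable_def .
    show "AE t in lebesgue. indicator {p..q} t *\<^sub>R - g t \<le> indicator {p..q} t *\<^sub>R f t"
      using bound by eventually_elim (auto simp: indicator_def)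
  qed
  moreover have "(LINT t:{p..q}|lebesgue. - g t) = - (LINT t:{p..q}|lebesgue. g t)"
    unfolding set_lebesgue_integral_def by simp
  ultimately show ?thesis
    by (simp add: set_lebesgue_integral_eq_integral(2)[OF f] set_lebesgue_integral_eq_integral(2)[OF g'])
qed

lemma integral_diff_eq:
  fixes f :: "real \<Rightarrow> real"
  assumes "f integrable_on {s..q}" "s \<le> p" "p \<le> q"
  shows "integral {s..q} f - integral {s..p} f = integral {p..q} f"
  using Henstock_Kurzweil_Integration.integral_combine[OF assms(2,3,1)] by simp

lemma abs_integral_le_const:
  fixes f :: "real \<Rightarrow> real"
  assumes f: "set_integrable lebesgue {p..q} f" and "p \<le> q"
    and bound: "AE t in lebesgue. p \<le> t \<and> t \<le> q \<longrightarrow> \<bar>f t\<bar> \<le> C"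
  shows "\<bar>integral {p..q} f\<bar> \<le> C * (q - p)"
  using abs_integral_le_AE[OF f, of "\<lambda>_. C"] bound \<open>p \<le> q\<close> by (simp add: mult.commute)

lemma AE_indefinite_integral_derivative_from:
  fixes f :: "real \<Rightarrow> real"
  assumes "\<And>d. f integrable_on {s..d}"
  shows "AE t in lebesgue. s < t \<longrightarrow> ((\<lambda>u. integral {s..u} f) has_real_derivative f t) (at t)"
proof -
  have "AE t in lebesgue. \<forall>n. s < t \<and> t < s + real n \<longrightarrow>
      ((\<lambda>u. integral {s..u} f) has_real_derivative f t) (at t)"
    unfolding AE_all_countable using AE_indefinite_integral_derivative[OF assms] by blast
  then show ?thesis
  proof eventually_elim
    fix t assume *: "\<forall>n. s < t \<and> t < s + real n \<longrightarrow>
      ((\<lambda>u. integral {s..u} f) has_real_derivative f t) (at t)"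
    obtain n where "t - s < real n" using reals_Archimedean2 by blast
    then show "s < t \<longrightarrow> ((\<lambda>u. integral {s..u} f) has_real_derivative f t) (at t)"
      using *[rule_format, of n] by auto
  qed
qed

lemma is_solution_imp_solves: "is_solution m a h s \<phi> x0 x \<Longrightarrow> solves m a h s x"
  unfolding is_solution_def solves_def
  by (auto simp: eq_neg_iff_add_eq_0[symmetric] elim!: eventually_mono)

lemma integral_solution_imp_is_solution:
  fixes H :: "real \<Rightarrow> real"
  assumes "0 \<le> s" and H: "\<And>u. s \<le> u \<Longrightarrow> H u = (\<Sum>k=1..m. a k u * x (h k u))"
    and H_int: "\<And>d. set_integrable lebesgue {s..d} H"
    and H_bound: "\<And>d. \<exists>K. AE t in lebesgue. s \<le> t \<and> t \<le> d \<longrightarrow> \<bar>H t\<bar> \<le> K"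
    and x: "\<And>t. s \<le> t \<Longrightarrow> x t = x0 - integral {s..t} H" and hist: "\<And>t. t < s \<Longrightarrow> x t = \<phi> t"
  shows "is_solution m a h s \<phi> x0 x"
  unfolding is_solution_def locally_abs_continuous_from_def
proof (intro conjI allI impI)
  note int = set_lebesgue_integral_eq_integral(1)[OF H_int]
  show "x t = \<phi> t" if "t < s" for t using hist that by simp
  show "x s = x0" using x[of s] by simp
  show "abs_continuous_on_interval s d x" for d
  proof -
    obtain K where K: "AE t in lebesgue. s \<le> t \<and> t \<le> d \<longrightarrow> \<bar>H t\<bar> \<le> K" using H_bound by blast
    show ?thesis
    proof (rule abs_continuous_lipschitz)
      fix u v assume uv: "s \<le> u" "u \<le> v" "v \<le> d"
      have "\<bar>integral {u..v} H\<bar> \<le> K * (v - u)"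
      proof (rule abs_integral_le_const)
        show "set_integrable lebesgue {u..v} H"
          by (rule set_integrable_subset[OF H_int[of d]]) (use uv in auto)
        show "AE t in lebesgue. u \<le> t \<and> t \<le> v \<longrightarrow> \<bar>H t\<bar> \<le> K" using K by eventually_elim (use uv in auto)
      qed fact
      then show "\<bar>x v - x u\<bar> \<le> K * (v - u)"
        using integral_diff_eq[OF int uv(1,2)] uv by (simp add: x)
    qed
  qed
  have "AE t in lebesgue. t \<noteq> s" by (rule AE_completion[OF AE_lborel_singleton])
  then show "AE t in lebesgue. s \<le> t \<longrightarrow>
      (\<exists>x'. (x has_real_derivative x') (at t) \<and> x' + (\<Sum>k=1..m. a k t * x (h k t)) = 0)"
    using AE_indefinite_integral_derivative_from[OF int]
  proof (eventually_elim, intro impI exI conjI)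
    fix t assume t: "s < t \<longrightarrow> ((\<lambda>u. integral {s..u} H) has_real_derivative H t) (at t)" "t \<noteq> s" "s \<le> t"
    have "((\<lambda>u. x0 - integral {s..u} H) has_real_derivative - H t) (at t)"
      using t by (auto intro!: derivative_eq_intros)
    then show "(x has_real_derivative - H t) (at t)"
      by (rule has_field_derivative_transform_within_open[of _ _ _ "{s<..}"]) (use t x in auto)
    show "- H t + (\<Sum>k=1..m. a k t * x (h k t)) = 0" using H t by simp
  qed
qed

lemma integral_exp_le:
  fixes lam :: real
  assumes "0 < lam" "s \<le> t" "0 \<le> c"
  shows "integral {s..t} (\<lambda>u. c * exp (lam * (u - s))) \<le> c / lam * exp (lam * (t - s))"
proof -
  have "((\<lambda>u. c * exp (lam * (u - s))) has_integral
      c / lam * exp (lam * (t - s)) - c / lam * exp (lam * (s - s))) {s..t}"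
    by (rule fundamental_theorem_of_calculus[OF assms(2)])
       (use assms in \<open>auto intro!: derivative_eq_intros simp: has_real_derivative_iff_has_vector_derivative[symmetric]\<close>)
  then have "integral {s..t} (\<lambda>u. c * exp (lam * (u - s)))
      = c / lam * exp (lam * (t - s)) - c / lam * exp (lam * (s - s))" by (rule integral_unique)
  moreover have "0 \<le> c / lam * exp (lam * (s - s))" using assms by simp
  ultimately show ?thesis by linarith
qed

text \<open>Banach's fixed point theorem for the integral equation, in the space of functions bounded by
  a multiple of \<open>exp (lam * (t - s))\<close>; the unknown \<open>f\<close> is the solution divided by that weight.\<close>

lemma fundamental_solution_exists:
  assumes a: "\<And>k. k \<in> {1..m} \<Longrightarrow> a k \<in> borel_measurable (lebesgue_on {0..})"
    and h: "\<And>k. k \<in> {1..m} \<Longrightarrow> h k \<in> borel_measurable (lebesgue_on {0..})"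
    and h_le: "\<And>k t. k \<in> {1..m} \<Longrightarrow> 0 \<le> t \<Longrightarrow> h k t \<le> t"
    and bound: "AE t in lebesgue. 0 \<le> t \<longrightarrow> (\<Sum>k=1..m. \<bar>a k t\<bar>) \<le> C" and s: "0 \<le> s"
  shows "\<exists>x. is_solution m a h s (\<lambda>_. 0) 1 x"
proof -
  \<comment> \<open>Makes the integral operator a contraction with factor \<open>1 / 2\<close> in
    the weighted norm.\<close>
  define lam where "lam = 2 * \<bar>C\<bar> + 1"
  have lam: "0 < lam" "\<bar>C\<bar> / lam \<le> 1 / 2" by (auto simp: lam_def field_simps)
  \<comment> \<open>Removes the weight and builds in the zero history before
    \<open>s\<close>.\<close>
  define w where "w f y = (if s \<le> y then exp (lam * (y - s)) * f y else 0)" for f :: "real \<Rightarrow> real" and y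
  define G where "G f u = (\<Sum>k=1..m. a k u * w f (h k u))" for f u
  define F where "F f t = exp (- lam * (t - s)) * (1 - integral {s..t} (G f))" for f t
  \<comment> \<open>Borel measurability of the outer function is what permits composition with the
    merely Lebesgue measurable \<open>h k\<close>.\<close>
  have w_meas: "w f \<in> borel_measurable borel" if "continuous_on UNIV f" for f
  proof -
    have [measurable]: "f \<in> borel_measurable borel" by (rule borel_measurable_continuous_onI[OF that])
    show ?thesis unfolding w_def[abs_def] by measurable
  qed
  have G_meas: "G f \<in> borel_measurable (lebesgue_on {0..})" if "continuous_on UNIV f" for f
    unfolding G_def
    by (intro borel_measurable_sum borel_measurable_times a measurable_compose[OF h w_meas[OF that]])
  have G_bound: "AE u in lebesgue. s \<le> u \<and> u \<le> t \<longrightarrow> \<bar>G f u\<bar> \<le> \<bar>C\<bar> * M * exp (lam * (u - s))"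
    if f: "\<And>y. \<bar>f y\<bar> \<le> M" for f M t
    using bound
  proof (eventually_elim, intro impI)
    fix u assume u: "0 \<le> u \<longrightarrow> (\<Sum>k=1..m. \<bar>a k u\<bar>) \<le> C" "s \<le> u \<and> u \<le> t"
    have M: "0 \<le> M" using f[of 0] by linarith
    have "\<bar>G f u\<bar> \<le> (\<Sum>k=1..m. \<bar>a k u * w f (h k u)\<bar>)" unfolding G_def by (rule sum_abs)
    also have "\<dots> \<le> (\<Sum>k=1..m. \<bar>a k u\<bar> * (M * exp (lam * (u - s))))"
    proof (rule sum_mono)
      fix k assume k: "k \<in> {1..m}"
      have "\<bar>w f (h k u)\<bar> \<le> M * exp (lam * (u - s))"
      proof (cases "s \<le> h k u")
        case True
        have "exp (lam * (h k u - s)) * \<bar>f (h k u)\<bar> \<le> exp (lam * (u - s)) * M"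
          using f[of "h k u"] h_le[OF k, of u] u s lam by (intro mult_mono) auto
        with True show ?thesis by (simp add: w_def abs_mult mult.commute)
      qed (use M in \<open>simp add: w_def\<close>)
      then show "\<bar>a k u * w f (h k u)\<bar> \<le> \<bar>a k u\<bar> * (M * exp (lam * (u - s)))"
        unfolding abs_mult by (intro mult_left_mono) auto
    qed
    also have "\<dots> = (\<Sum>k=1..m. \<bar>a k u\<bar>) * (M * exp (lam * (u - s)))" by (rule sum_distrib_right[symmetric])
    also have "\<dots> \<le> \<bar>C\<bar> * (M * exp (lam * (u - s)))"
      using u s M by (intro mult_right_mono) auto
    finally show "\<bar>G f u\<bar> \<le> \<bar>C\<bar> * M * exp (lam * (u - s))" by (simp add: mult.assoc)
  qed
  have G_const: "AE u in lebesgue. s \<le> u \<and> u \<le> t \<longrightarrow> \<bar>G f u\<bar> \<le> \<bar>C\<bar> * M * exp (lam * (t - s))"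
    if f: "\<And>y. \<bar>f y\<bar> \<le> M" for f M t
    using G_bound[OF f]
  proof (eventually_elim, intro impI)
    fix u assume u: "s \<le> u \<and> u \<le> t \<longrightarrow> \<bar>G f u\<bar> \<le> \<bar>C\<bar> * M * exp (lam * (u - s))" "s \<le> u \<and> u \<le> t"
    have "0 \<le> M" using f[of 0] by linarith
    then have "\<bar>C\<bar> * M * exp (lam * (u - s)) \<le> \<bar>C\<bar> * M * exp (lam * (t - s))"
      using u lam by (intro mult_left_mono) auto
    with u show "\<bar>G f u\<bar> \<le> \<bar>C\<bar> * M * exp (lam * (t - s))" by simp
  qed
  have G_int: "set_integrable lebesgue {s..t} (G f)"
    if "continuous_on UNIV f" "\<And>y. \<bar>f y\<bar> \<le> M" for f M t
    by (rule ess_bounded_set_integrable[OF G_meas s G_const]) (use that in auto)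
  have G_le: "\<bar>integral {s..t} (G f)\<bar> \<le> M / 2 * exp (lam * (t - s))"
    if f: "continuous_on UNIV f" "\<And>y. \<bar>f y\<bar> \<le> M" and t: "s \<le> t" for f M t
  proof -
    have M: "0 \<le> M" using f(2)[of 0] by linarith
    have "\<bar>integral {s..t} (G f)\<bar> \<le> integral {s..t} (\<lambda>u. (\<bar>C\<bar> * M) * exp (lam * (u - s)))"
      by (rule abs_integral_le_AE[OF G_int[OF f] _ G_bound[OF f(2)]]) (intro continuous_intros)
    also have "\<dots> \<le> \<bar>C\<bar> * M / lam * exp (lam * (t - s))"
      using lam t M by (intro integral_exp_le) auto
    also have "\<dots> = \<bar>C\<bar> / lam * (M * exp (lam * (t - s)))" by simp
    also have "\<dots> \<le> 1 / 2 * (M * exp (lam * (t - s)))" using lam M by (intro mult_right_mono) auto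
    finally show ?thesis by simp
  qed
  have cF: "continuous_on UNIV (\<lambda>t. F f (max t s))" if f: "continuous_on UNIV f" "\<And>y. \<bar>f y\<bar> \<le> M" for f M
  proof -
    have "continuous_on {s..} (F f)" unfolding F_def[abs_def]
      by (rule continuous_on_atLeast)
         (intro continuous_intros indefinite_integral_continuous_1
           set_lebesgue_integral_eq_integral(1)[OF G_int[OF f]])
    then show ?thesis by (rule continuous_on_compose2) (auto intro!: continuous_intros)
  qed
  have bF: "\<bar>F f (max t s)\<bar> \<le> 1 + M / 2" if f: "continuous_on UNIV f" "\<And>y. \<bar>f y\<bar> \<le> M" for f M t
  proof -
    let ?t = "max t s"
    have "\<bar>F f ?t\<bar> = exp (- lam * (?t - s)) * \<bar>1 - integral {s..?t} (G f)\<bar>"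
      by (simp add: F_def abs_mult)
    also have "\<dots> \<le> exp (- lam * (?t - s)) * (1 + M / 2 * exp (lam * (?t - s)))"
      using G_le[OF f, of ?t] by (intro mult_left_mono) auto
    also have "\<dots> = exp (- lam * (?t - s)) + M / 2"
      by (simp add: distrib_left exp_minus)
    also have "\<dots> \<le> 1 + M / 2" using lam by simp
    finally show ?thesis .
  qed
  \<comment> \<open>\<open>max t s\<close> freezes the values to the left of \<open>s\<close>, so
    that the operator acts on bounded continuous functions on the whole line.\<close>
  define \<Phi> where "\<Phi> f = Bcontfun (\<lambda>t. F (apply_bcontfun f) (max t s))" for f :: "real \<Rightarrow>\<^sub>C real"
  have fb: "\<bar>apply_bcontfun f y\<bar> \<le> norm f" for f :: "real \<Rightarrow>\<^sub>C real" and y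
    using norm_bounded[of f y] by simp
  have \<Phi>: "apply_bcontfun (\<Phi> f) t = F (apply_bcontfun f) (max t s)" for f t
    unfolding \<Phi>_def
    by (subst Bcontfun_inverse[OF bcontfun_normI])
       (use cF[OF continuous_on_apply_bcontfun fb] bF[OF continuous_on_apply_bcontfun fb] in auto)
  have "dist (\<Phi> f) (\<Phi> g) \<le> 1 / 2 * dist f g" for f g
  proof (rule dist_bound)
    fix t
    let ?t = "max t s" and ?d = "\<lambda>y. apply_bcontfun f y - apply_bcontfun g y"
    have d: "\<bar>?d y\<bar> \<le> dist f g" for y using dist_bounded[of f y g] by (simp add: dist_real_def)
    have cd: "continuous_on UNIV ?d" by (intro continuous_intros) auto
    have "G ?d = (\<lambda>u. G (apply_bcontfun f) u - G (apply_bcontfun g) u)"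
      by (auto simp: G_def w_def fun_eq_iff sum_subtractf[symmetric] algebra_simps intro!: sum.cong)
    then have eq: "integral {s..?t} (G ?d) = integral {s..?t} (G (apply_bcontfun f)) - integral {s..?t} (G (apply_bcontfun g))"
      by (simp add: Henstock_Kurzweil_Integration.integral_diff
          set_lebesgue_integral_eq_integral(1)[OF G_int[OF continuous_on_apply_bcontfun fb]])
    have "F (apply_bcontfun f) ?t - F (apply_bcontfun g) ?t = - exp (- lam * (?t - s)) * integral {s..?t} (G ?d)"
      unfolding F_def eq by (simp add: right_diff_distrib)
    then have "dist (\<Phi> f t) (\<Phi> g t) = exp (- lam * (?t - s)) * \<bar>integral {s..?t} (G ?d)\<bar>"
      by (simp add: \<Phi> dist_real_def abs_mult)
    also have "\<dots> \<le> exp (- lam * (?t - s)) * (dist f g / 2 * exp (lam * (?t - s)))"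
      using G_le[OF cd d, of ?t] by (intro mult_left_mono) auto
    also have "\<dots> = 1 / 2 * dist f g" by (simp add: exp_minus)
    finally show "dist (\<Phi> f t) (\<Phi> g t) \<le> 1 / 2 * dist f g" .
  qed
  then have "\<exists>!f. \<Phi> f = f" by (intro banach_fix_type[of "1/2"]) auto
  then obtain f where f: "\<Phi> f = f" by blast
  define x where "x = w (apply_bcontfun f)"
  have "is_solution m a h s (\<lambda>_. 0) 1 x"
  proof (rule integral_solution_imp_is_solution[OF s])
    show "G (apply_bcontfun f) u = (\<Sum>k=1..m. a k u * x (h k u))" for u by (simp add: G_def x_def)
    show "set_integrable lebesgue {s..d} (G (apply_bcontfun f))" for d
      by (rule G_int[OF continuous_on_apply_bcontfun fb])
    show "\<exists>K. AE t in lebesgue. s \<le> t \<and> t \<le> d \<longrightarrow> \<bar>G (apply_bcontfun f) t\<bar> \<le> K" for d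
      by (rule exI, rule G_const[of "apply_bcontfun f", OF fb])
    show "x t = 1 - integral {s..t} (G (apply_bcontfun f))" if "s \<le> t" for t
    proof -
      have "apply_bcontfun f t = F (apply_bcontfun f) t" using \<Phi>[of f t] f that by (simp add: max_def)
      then show ?thesis using that by (simp add: x_def w_def F_def exp_minus)
    qed
    show "x t = 0" if "t < s" for t using that by (simp add: x_def w_def)
  qed
  then show ?thesis by blast
qed

section \<open>Stability\<close>

lemma solves_diff:
  assumes "solves m a h s x" "solves m a h s y"
  shows "solves m a h s (\<lambda>t. x t + - y t)"
  unfolding solves_def locally_abs_continuous_from_def
proof (intro conjI allI impI)
  show "abs_continuous_on_interval s d (\<lambda>t. x t + - y t)" if "s < d" for d
    using assms that unfolding solves_def locally_abs_continuous_from_def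
    by (intro abs_continuous_add abs_continuous_uminus) auto
  show "AE t in lebesgue. s \<le> t \<longrightarrow>
      ((\<lambda>t. x t + - y t) has_real_derivative - (\<Sum>k=1..m. a k t * (x (h k t) + - y (h k t)))) (at t)"
    using assms[unfolded solves_def, THEN conjunct2]
  proof (eventually_elim, intro impI)
    fix t assume "s \<le> t \<longrightarrow> (x has_real_derivative - (\<Sum>k=1..m. a k t * x (h k t))) (at t)"
      "s \<le> t \<longrightarrow> (y has_real_derivative - (\<Sum>k=1..m. a k t * y (h k t))) (at t)" "s \<le> t"
    then have "((\<lambda>t. x t + - y t) has_real_derivative
        - (\<Sum>k=1..m. a k t * x (h k t)) + - (- (\<Sum>k=1..m. a k t * y (h k t)))) (at t)"
      by (intro DERIV_add DERIV_minus) auto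
    then show "((\<lambda>t. x t + - y t) has_real_derivative - (\<Sum>k=1..m. a k t * (x (h k t) + - y (h k t)))) (at t)"
      by (simp add: sum_subtractf right_diff_distrib)
  qed
qed

lemma initial_function_bound:
  assumes "initial_function t0 \<phi>" "v < t0"
  shows "\<bar>\<phi> v\<bar> \<le> (SUP t\<in>{..<t0}. \<bar>\<phi> t\<bar>)"
proof -
  obtain M where "\<And>v. v < t0 \<Longrightarrow> \<bar>\<phi> v\<bar> \<le> M"
    using assms(1) unfolding initial_function_def bounded_iff by auto
  then have "bdd_above ((\<lambda>t. \<bar>\<phi> t\<bar>) ` {..<t0})" by (intro bdd_aboveI2[where M = M]) auto
  then show ?thesis using assms(2) by (intro cSUP_upper) auto
qed

lemma initial_data_bound:
  assumes "initial_function t0 \<phi>" "is_solution m a h t0 \<phi> x0 x" "v \<le> t0"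
  shows "\<bar>x v\<bar> \<le> \<bar>x t0\<bar> + (SUP t\<in>{..<t0}. \<bar>\<phi> t\<bar>)"
proof -
  have "0 \<le> (SUP t\<in>{..<t0}. \<bar>\<phi> t\<bar>)"
    using initial_function_bound[OF assms(1), of "t0 - 1"] by simp
  moreover have "x v = \<phi> v" if "v < t0" using assms(2) that by (simp add: is_solution_def)
  ultimately show ?thesis
    using initial_function_bound[OF assms(1), of v] assms(3) by (cases "v < t0") auto
qed

context delay_equation
begin

text \<open>The difference of two solutions has zero history, so \<open>growth_bound\<close> with
  \<open>A = 0\<close> applies.\<close>

lemma solution_unique:
  assumes "0 \<le> s" "is_solution m a h s \<phi> x0 x" "is_solution m a h s \<phi> x0 y"
  shows "x = y"
proof
  fix t
  let ?d = "\<lambda>t. x t + - y t"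
  have d: "solves m a h s ?d" using assms by (intro solves_diff is_solution_imp_solves)
  have hist: "\<bar>?d v\<bar> \<le> 0" if "v \<le> s" for v
    using assms(2,3) that unfolding is_solution_def by (cases "v = s") auto
  show "x t = y t"
  proof (cases "t \<le> s")
    case True
    then show ?thesis using hist[of t] by simp
  next
    case False
    then show ?thesis using growth_bound[OF d assms(1) hist, of t] by simp
  qed
qed

lemma filterlim_B: "filterlim B at_top at_top"
  unfolding filterlim_at_top eventually_at_top_linorder
proof
  fix Z
  obtain t where t: "0 \<le> t" "Z \<le> B t" using B_unbounded by blast
  then have "\<forall>u\<ge>t. Z \<le> B u" using B_mono order.trans by blast
  then show "\<exists>N. \<forall>u\<ge>N. Z \<le> B u" ..
qed

lemma asymptotically_stable: "asymptotically_stable m a h"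
proof -
  obtain K where K: "0 < K"
    "\<And>s x A t. 0 \<le> s \<Longrightarrow> solves m a h s x \<Longrightarrow> (\<And>v. v \<le> s \<Longrightarrow> \<bar>x v\<bar> \<le> A) \<Longrightarrow> s \<le> t \<Longrightarrow>
      \<bar>x t\<bar> \<le> K * A * exp (- rate * (B t - B s))" using uniform_decay by blast
  have est: "\<bar>x t\<bar> \<le> K * (\<bar>x t0\<bar> + (SUP t\<in>{..<t0}. \<bar>\<phi> t\<bar>)) * exp (- rate * (B t - B t0))"
    if "0 \<le> t0" "initial_function t0 \<phi>" "is_solution m a h t0 \<phi> x0 x" "t0 \<le> t" for t0 \<phi> x0 x t
    by (rule K(2)[OF that(1) is_solution_imp_solves[OF that(3)] initial_data_bound[OF that(2,3)] that(4)])
  show ?thesis unfolding asymptotically_stable_def stable_def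
  proof (intro conjI allI impI)
    fix t0 \<epsilon> :: real assume t0: "0 \<le> t0" and \<epsilon>: "0 < \<epsilon>"
    show "\<exists>\<delta>>0. \<forall>\<phi> x0 x.
        initial_function t0 \<phi> \<and> is_solution m a h t0 \<phi> x0 x \<and>
        (SUP t\<in>{..<t0}. \<bar>\<phi> t\<bar>) + \<bar>x t0\<bar> < \<delta>
        \<longrightarrow> (\<forall>t\<ge>t0. \<bar>x t\<bar> < \<epsilon>)"
    proof (intro exI[of _ "\<epsilon> / K"] conjI allI impI)
      fix \<phi> x0 x t
      assume *: "initial_function t0 \<phi> \<and> is_solution m a h t0 \<phi> x0 x \<and>
        (SUP t\<in>{..<t0}. \<bar>\<phi> t\<bar>) + \<bar>x t0\<bar> < \<epsilon> / K" and t: "t0 \<le> t"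
      let ?A = "\<bar>x t0\<bar> + (SUP t\<in>{..<t0}. \<bar>\<phi> t\<bar>)"
      have A: "0 \<le> ?A" "?A < \<epsilon> / K" using initial_data_bound[of t0 \<phi> m a h x0 x t0] * by linarith+
      have "\<bar>x t\<bar> \<le> K * ?A * exp (- rate * (B t - B t0))" using est[of t0 \<phi> x0 x t] * t0 t by blast
      also have "\<dots> \<le> K * ?A * 1"
        using K(1) A rate_pos B_mono[OF t0 t] by (intro mult_left_mono) auto
      also have "\<dots> < \<epsilon>" using A(2) K(1) by (simp add: pos_less_divide_eq mult.commute)
      finally show "\<bar>x t\<bar> < \<epsilon>" .
    qed (use \<epsilon> K in auto)
  next
    fix t0 \<phi> x0 x assume t0: "0 \<le> t0" and x: "initial_function t0 \<phi> \<and> is_solution m a h t0 \<phi> x0 x"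
    let ?c = "K * (\<bar>x t0\<bar> + (SUP t\<in>{..<t0}. \<bar>\<phi> t\<bar>))"
    have "filterlim (\<lambda>t. rate * (- B t0 + B t)) at_top at_top"
      by (intro filterlim_tendsto_pos_mult_at_top[OF tendsto_const rate_pos]
          filterlim_tendsto_add_at_top[OF tendsto_const] filterlim_B)
    then have "filterlim (\<lambda>t. - rate * (B t - B t0)) at_bot at_top"
      by (simp add: filterlim_uminus_at_bot)
    then have "((\<lambda>t. exp (- rate * (B t - B t0))) \<longlongrightarrow> 0) at_top"
      by (rule filterlim_compose[OF exp_at_bot])
    then have lim: "((\<lambda>t. ?c * exp (- rate * (B t - B t0))) \<longlongrightarrow> 0) at_top"
      by (rule tendsto_mult_right_zero)
    show "(x \<longlongrightarrow> 0) at_top"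
    proof (rule Lim_null_comparison[OF _ lim])
      show "\<forall>\<^sub>F t in at_top. norm (x t) \<le> ?c * exp (- rate * (B t - B t0))"
        using eventually_ge_at_top[of t0] by eventually_elim (use est t0 x in auto)
    qed
  qed
qed

context
  fixes \<beta> \<gamma> :: real
  assumes \<beta>: "0 < \<beta>" and B_linear: "\<And>s t. 0 \<le> s \<Longrightarrow> s \<le> t \<Longrightarrow> \<beta> * (t - s) - \<gamma> \<le> B t - B s"
begin

lemma exponential_decay_in_time:
  obtains K \<mu> where "K > 0" "\<mu> > 0"
    "\<And>s x A t. 0 \<le> s \<Longrightarrow> solves m a h s x \<Longrightarrow> (\<And>v. v \<le> s \<Longrightarrow> \<bar>x v\<bar> \<le> A) \<Longrightarrow> s \<le> t \<Longrightarrow>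
      \<bar>x t\<bar> \<le> K * exp (- \<mu> * (t - s)) * A"
proof -
  obtain K where K: "0 < K"
    "\<And>s x A t. 0 \<le> s \<Longrightarrow> solves m a h s x \<Longrightarrow> (\<And>v. v \<le> s \<Longrightarrow> \<bar>x v\<bar> \<le> A) \<Longrightarrow> s \<le> t \<Longrightarrow>
      \<bar>x t\<bar> \<le> K * A * exp (- rate * (B t - B s))" using uniform_decay by blast
  show thesis
  proof (rule that[of "K * exp (rate * \<gamma>)" "rate * \<beta>"])
    fix s x A t
    assume *: "0 \<le> s" "solves m a h s x" "\<And>v. v \<le> s \<Longrightarrow> \<bar>x v\<bar> \<le> A" "s \<le> t"
    have A: "0 \<le> A" using *(3)[of s] by linarith
    have "\<bar>x t\<bar> \<le> K * A * exp (- rate * (B t - B s))" by (rule K(2)[OF *])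
    also have "exp (- rate * (B t - B s)) \<le> exp (rate * \<gamma> + - (rate * \<beta>) * (t - s))"
      using mult_left_mono[OF B_linear[OF *(1,4)], of rate] rate_pos by (simp add: algebra_simps)
    then have "K * A * exp (- rate * (B t - B s)) \<le> K * A * exp (rate * \<gamma> + - (rate * \<beta>) * (t - s))"
      using A K(1) by (intro mult_left_mono) auto
    finally show "\<bar>x t\<bar> \<le> K * exp (rate * \<gamma>) * exp (- (rate * \<beta>) * (t - s)) * A"
      unfolding exp_add by (simp only: mult_ac)
  qed (use K rate_pos \<beta> in auto)
qed

lemma exponentially_stable: "exponentially_stable m a h"
proof -
  obtain K \<mu> where K: "K > 0" "\<mu> > 0"
    "\<And>s x A t. 0 \<le> s \<Longrightarrow> solves m a h s x \<Longrightarrow> (\<And>v. v \<le> s \<Longrightarrow> \<bar>x v\<bar> \<le> A) \<Longrightarrow> s \<le> t \<Longrightarrow>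
      \<bar>x t\<bar> \<le> K * exp (- \<mu> * (t - s)) * A" using exponential_decay_in_time by blast
  show ?thesis unfolding exponentially_stable_def
  proof (rule exI[of _ K], rule conjI[OF K(1)], rule exI[of _ \<mu>], rule conjI[OF K(2)], intro allI impI)
    fix t0 \<phi> x0 x t
    assume *: "0 \<le> t0" "initial_function t0 \<phi> \<and> is_solution m a h t0 \<phi> x0 x" "t0 \<le> t"
    show "\<bar>x t\<bar> \<le> K * exp (- \<mu> * (t - t0)) * (\<bar>x t0\<bar> + (SUP t\<in>{..<t0}. \<bar>\<phi> t\<bar>))"
      by (rule K(3)[OF *(1) is_solution_imp_solves initial_data_bound *(3)]) (use * in auto)
  qed
qed

text \<open>Existence and uniqueness together identify the function selected by \<open>THE\<close>;
  its history is bounded by \<open>1\<close>.\<close>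

lemma exponential_estimation:
  assumes ex: "\<And>s. 0 \<le> s \<Longrightarrow> \<exists>x. is_solution m a h s (\<lambda>_. 0) 1 x"
  shows "has_exponential_estimation (fundamental_function m a h)"
proof -
  obtain K \<mu> where K: "K > 0" "\<mu> > 0"
    "\<And>s x A t. 0 \<le> s \<Longrightarrow> solves m a h s x \<Longrightarrow> (\<And>v. v \<le> s \<Longrightarrow> \<bar>x v\<bar> \<le> A) \<Longrightarrow> s \<le> t \<Longrightarrow>
      \<bar>x t\<bar> \<le> K * exp (- \<mu> * (t - s)) * A" using exponential_decay_in_time by blast
  show ?thesis unfolding has_exponential_estimation_def
  proof (rule exI[of _ K], rule conjI[OF K(1)], rule exI[of _ \<mu>], rule conjI[OF K(2)], intro allI impI)
    fix s t :: real assume s: "0 \<le> s" "s \<le> t"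
    obtain x where x: "is_solution m a h s (\<lambda>_. 0) 1 x" using ex[OF s(1)] by blast
    then have "(THE x. is_solution m a h s (\<lambda>_. 0) 1 x) = x"
      using solution_unique[OF s(1)] by (intro the_equality) auto
    then have X: "fundamental_function m a h t s = x t" by (simp add: fundamental_function_def)
    have "\<bar>x v\<bar> \<le> 1" if "v \<le> s" for v
      using x that unfolding is_solution_def by (cases "v = s") auto
    then have "\<bar>x t\<bar> \<le> K * exp (- \<mu> * (t - s)) * 1" by (rule K(3)[OF s(1) is_solution_imp_solves[OF x] _ s(2)])
    then show "\<bar>fundamental_function m a h t s\<bar> \<le> K * exp (- \<mu> * (t - s))" by (simp add: X)
  qed
qed

end

end

section \<open>From the limit conditions to the hypotheses of the locale\<close>

lemma one_plus_inverse_exp_1_less: "1 + 1 / exp 1 < (13679/10000 :: real)"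
proof -
  \<comment> \<open>Nine terms of the series give \<open>27182/10000\<close>; four decimals are
    required because \<open>13679/10000\<close> exceeds \<open>1 + 1/e\<close> by only about
    \<open>0.00002\<close>.\<close>
  have "(\<Sum>i<9. inverse (fact i) *\<^sub>R (1::real) ^ i) \<le> exp 1"
    unfolding exp_def by (rule sum_le_suminf[OF summable_exp_generic]) auto
  then have "27182/10000 \<le> exp (1::real)" by (simp add: fact_numeral eval_nat_numeral lessThan_Suc)
  then have "1 / exp 1 \<le> 1 / (27182/10000 :: real)" by (intro divide_left_mono) auto
  then show ?thesis by simp
qed

text \<open>Counts whole steps of length \<open>R\<close> after time \<open>N\<close>. The
  subtracted constant covers the stretch before \<open>N\<close>, with
  \<open>\<kappa> * N / R\<close>, and the incomplete last step, with
  \<open>\<kappa>\<close>.\<close>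

lemma linear_growth_from_increments:
  fixes B :: "real \<Rightarrow> real"
  assumes mono: "\<And>s t. 0 \<le> s \<Longrightarrow> s \<le> t \<Longrightarrow> B s \<le> B t" and R: "0 < R" and \<kappa>: "0 < \<kappa>" and N: "0 \<le> N"
    and gain: "\<And>t. N \<le> t \<Longrightarrow> \<kappa> \<le> B (t + R) - B t"
    and st: "0 \<le> s" "s \<le> t"
  shows "\<kappa> / R * (t - s) - \<kappa> * (N / R + 1) \<le> B t - B s"
proof (cases "t \<le> max s N")
  case True
  have "\<kappa> / R * (t - s) \<le> \<kappa> / R * N" using True st R \<kappa> N by (intro mult_left_mono) auto
  then have "\<kappa> / R * (t - s) - \<kappa> * (N / R + 1) \<le> 0" using \<kappa> by (simp add: algebra_simps)
  then show ?thesis using mono[OF st] by linarith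
next
  case False
  define s' where "s' = max s N"
  have s': "s \<le> s'" "N \<le> s'" "0 \<le> s'" "s' \<le> t" "s' \<le> s + N" using False st N by (auto simp: s'_def)
  define y where "y = (t - s') / R"
  define n where "n = nat \<lfloor>y\<rfloor>"
  have "0 \<le> y" using s' R by (simp add: y_def)
  then have n: "real n \<le> y" "y \<le> real n + 1" unfolding n_def by linarith+
  have steps: "real n * \<kappa> \<le> B (s' + real n * R) - B s'" for n
  proof (induction n)
    case (Suc n)
    have "0 \<le> real n * R" using R by simp
    then have "\<kappa> \<le> B (s' + real n * R + R) - B (s' + real n * R)" using s' by (intro gain) linarith
    with Suc show ?case by (simp add: algebra_simps)
  qed simp
  have "real n * R \<le> t - s'" using n(1) R by (simp add: y_def pos_le_divide_eq)
  then have "B (s' + real n * R) \<le> B t" using s' R by (intro mono) auto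
  moreover have "B s \<le> B s'" using st s' by (intro mono)
  ultimately have "real n * \<kappa> \<le> B t - B s" using steps[of n] by linarith
  moreover have "(y - 1) * \<kappa> \<le> real n * \<kappa>" using n \<kappa> by (intro mult_right_mono) auto
  moreover have "\<kappa> / R * (t - s) - \<kappa> * (N / R + 1) \<le> (y - 1) * \<kappa>"
  proof -
    have "\<kappa> / R * (t - s) \<le> \<kappa> / R * (t - s' + N)" using s' R \<kappa> by (intro mult_left_mono) auto
    also have "\<dots> = y * \<kappa> + \<kappa> * (N / R)" using R by (simp add: y_def field_simps)
    finally show ?thesis by (simp add: algebra_simps)
  qed
  ultimately show ?thesis by linarith
qed

text \<open>By monotone convergence over \<open>[0, n]\<close>, a common bound of the finite
  integrals would bound the infinite one.\<close>

lemma unbounded_integral: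
  fixes b :: "real \<Rightarrow> real"
  assumes b: "b \<in> borel_measurable (lebesgue_on {0..})" and nonneg: "AE t in lebesgue. 0 \<le> t \<longrightarrow> 0 \<le> b t"
    and int: "\<And>d. set_integrable lebesgue {0..d} b"
    and infinite: "(\<integral>\<^sup>+t\<in>{0..}. ennreal (b t) \<partial>lebesgue) = \<infinity>"
  shows "\<exists>t\<ge>0. c \<le> integral {0..t} b"
proof (rule ccontr)
  assume "\<not> ?thesis"
  then have less: "integral {0..t} b < c" if "0 \<le> t" for t using that by force
  define f where "f n t = ennreal (indicator {0..real n} t *\<^sub>R b t)" for n :: nat and t
  have f_nn: "(\<integral>\<^sup>+t. f n t \<partial>lebesgue) \<le> ennreal c" for n
  proof -
    have "(\<integral>\<^sup>+t. f n t \<partial>lebesgue) = ennreal (LINT t:{0..real n}|lebesgue. b t)"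
      unfolding f_def set_lebesgue_integral_def
      using int[of "real n"] nonneg unfolding set_integrable_def
      by (intro nn_integral_eq_integral) (auto simp: indicator_def elim!: eventually_mono)
    also have "\<dots> \<le> ennreal c"
      using less[of "real n"] set_lebesgue_integral_eq_integral(2)[OF int[of "real n"]]
      by (intro ennreal_leI) auto
    finally show ?thesis .
  qed
  have "(\<integral>\<^sup>+t\<in>{0..}. ennreal (b t) \<partial>lebesgue) = (\<integral>\<^sup>+t. (SUP n. f n t) \<partial>lebesgue)"
  proof (rule nn_integral_cong)
    fix t :: real
    show "ennreal (b t) * indicator {0..} t = (SUP n. f n t)"
    proof (cases "0 \<le> t")
      case True
      obtain n0 where n0: "t \<le> real n0" using real_arch_simple by blast
      have "(SUP n. f n t) = ennreal (b t)"
      proof (rule antisym)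
        show "(SUP n. f n t) \<le> ennreal (b t)" by (rule SUP_least) (auto simp: f_def indicator_def)
        show "ennreal (b t) \<le> (SUP n. f n t)"
          by (rule SUP_upper2[of n0]) (use n0 True in \<open>auto simp: f_def\<close>)
      qed
      with True show ?thesis by simp
    qed (simp add: f_def)
  qed
  also have "\<dots> = (SUP n. \<integral>\<^sup>+t. f n t \<partial>lebesgue)"
  proof (rule nn_integral_monotone_convergence_SUP)
    show "incseq f" by (auto simp: incseq_def le_fun_def f_def indicator_def)
    show "f n \<in> borel_measurable lebesgue" for n
      using int[of "real n"] unfolding f_def set_integrable_def
      by (intro measurable_compose[OF _ measurable_ennreal] borel_measurable_integrable)
  qed
  also have "\<dots> \<le> ennreal c" by (rule SUP_least) (rule f_nn)
  finally show False using infinite by (simp add: top_unique)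
qed

lemma Limsup_finite_imp_eventually_bound:
  fixes f :: "real \<Rightarrow> real"
  assumes "Limsup F (\<lambda>t. ereal (f t)) < \<infinity>"
  shows "\<exists>r. eventually (\<lambda>t. f t < r) F"
proof -
  obtain r where "Limsup F (\<lambda>t. ereal (f t)) < ereal r" using ereal_dense2[OF assms] by blast
  from Limsup_lessD[OF this] show ?thesis by auto
qed

theorem theorem1:
  fixes m :: nat and a h :: "nat \<Rightarrow> real \<Rightarrow> real"
  assumes a_meas: "\<And>k. k \<in> {1..m} \<Longrightarrow> a k \<in> borel_measurable (lebesgue_on {0..})"
    and a_bdd: "\<And>k. k \<in> {1..m} \<Longrightarrow> \<exists>C. AE t in lebesgue_on {0..}. \<bar>a k t\<bar> \<le> C"
    and h_meas: "\<And>k. k \<in> {1..m} \<Longrightarrow> h k \<in> borel_measurable (lebesgue_on {0..})"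
    and h_le: "\<And>k t. k \<in> {1..m} \<Longrightarrow> t \<ge> 0 \<Longrightarrow> h k t \<le> t"
    and h_lim: "\<And>k. k \<in> {1..m} \<Longrightarrow> filterlim (h k) at_top at_top"
    and a_nonneg: "\<And>k. k \<in> {1..m} \<Longrightarrow> AE t in lebesgue_on {0..}. a k t \<ge> 0"
    and a_nonzero: "AE t in lebesgue_on {0..}. (\<Sum>k=1..m. a k t) \<noteq> 0"
    and limsup_quotient:
      "Limsup (inf at_top (principal {t. (\<Sum>i=1..m. a i t) \<noteq> 0}))
         (\<lambda>t. ereal (\<Sum>k=1..m. a k t / (\<Sum>i=1..m. a i t) *
                 (LINT s:{h k t..t}|lebesgue. (\<Sum>i=1..m. a i s))))
       < ereal (1 + 1 / exp 1)"
    and integral_infinite: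
      "(\<integral>\<^sup>+t\<in>{0..}. ennreal (\<Sum>k=1..m. a k t) \<partial>lebesgue) = \<infinity>"
    and limsup_integral:
      "\<And>k. k \<in> {1..m} \<Longrightarrow>
         Limsup at_top (\<lambda>t. ereal (LINT s:{h k t..t}|lebesgue. (\<Sum>i=1..m. a i s))) < \<infinity>"
  shows "asymptotically_stable m a h
    \<and> ((\<exists>R>0. Liminf at_top (\<lambda>t. ereal (LINT s:{t..t+R}|lebesgue. (\<Sum>k=1..m. a k s))) > 0)
        \<longrightarrow> has_exponential_estimation (fundamental_function m a h))
    \<and> ((\<exists>R>0. Liminf at_top (\<lambda>t. ereal (LINT s:{t..t+R}|lebesgue. (\<Sum>k=1..m. a k s))) > 0)
        \<and> (\<forall>k\<in>{1..m}. Limsup at_top (\<lambda>t. ereal (t - h k t)) < \<infinity>)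
        \<longrightarrow> exponentially_stable m a h)"
proof -
  define b where "b t = (\<Sum>k=1..m. a k t)" for t
  define B where "B t = integral {0..t} b" for t
  have AE0: "(AE t in lebesgue_on {0..}. P t) \<longleftrightarrow> (AE t in lebesgue. 0 \<le> t \<longrightarrow> P t)" for P :: "real \<Rightarrow> bool"
    by (subst AE_restrict_space_iff) auto
  obtain Ck where Ck: "\<And>k. k \<in> {1..m} \<Longrightarrow> AE t in lebesgue. 0 \<le> t \<longrightarrow> \<bar>a k t\<bar> \<le> Ck k"
    using a_bdd unfolding AE0 by metis
  define C where "C = (\<Sum>k=1..m. Ck k)"
  have "AE t in lebesgue. \<forall>k\<in>{1..m}. 0 \<le> t \<longrightarrow> \<bar>a k t\<bar> \<le> Ck k"
    using Ck by (intro AE_finite_allI) auto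
  then have aC: "AE t in lebesgue. 0 \<le> t \<longrightarrow> (\<Sum>k=1..m. \<bar>a k t\<bar>) \<le> C"
    by eventually_elim (auto simp: C_def intro!: sum_mono)
  have "AE t in lebesgue. \<forall>k\<in>{1..m}. 0 \<le> t \<longrightarrow> 0 \<le> a k t"
    using a_nonneg unfolding AE0 by (intro AE_finite_allI) auto
  then have a0: "AE t in lebesgue. 0 \<le> t \<longrightarrow> (\<forall>k\<in>{1..m}. 0 \<le> a k t)"
    by eventually_elim auto
  have b0: "AE t in lebesgue. 0 \<le> t \<longrightarrow> 0 \<le> b t"
    using a0 by eventually_elim (auto simp: b_def intro!: sum_nonneg)
  have bC: "AE t in lebesgue. 0 \<le> t \<longrightarrow> \<bar>b t\<bar> \<le> C"
    using aC by eventually_elim (auto simp: b_def intro: order.trans[OF sum_abs])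
  have b_meas: "b \<in> borel_measurable (lebesgue_on {0..})"
    unfolding b_def by (intro borel_measurable_sum a_meas)
  have b_set: "set_integrable lebesgue {p..q} b" if "0 \<le> p" for p q
    by (rule ess_bounded_set_integrable[OF b_meas that, of q C])
       (use bC in eventually_elim, use that in auto)
  note b_int = set_lebesgue_integral_eq_integral[OF b_set]
  have LB: "(LINT u:{p..q}|lebesgue. b u) = B q - B p" if "0 \<le> p" "p \<le> q" for p q
    unfolding b_int(2)[OF that(1)] B_def
    using integral_diff_eq[of b 0 q p] b_int(1)[of 0 q] that by simp
  have B_mono: "B p \<le> B q" if "0 \<le> p" "p \<le> q" for p q
  proof -
    have "0 \<le> (LINT u:{p..q}|lebesgue. b u)"
      unfolding set_lebesgue_integral_def
      by (rule integral_nonneg_AE) (use b0 in eventually_elim, use that in \<open>auto simp: indicator_def\<close>)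
    then show ?thesis using LB[OF that] by simp
  qed
  have B_lip: "B q - B p \<le> C * (q - p)" if "0 \<le> p" "p \<le> q" for p q
  proof -
    have "\<bar>integral {p..q} b\<bar> \<le> C * (q - p)"
      by (rule abs_integral_le_const[OF b_set[OF that(1)] that(2)])
         (use bC in eventually_elim, use that in auto)
    then show ?thesis using LB[OF that] b_int(2)[OF that(1), of q] by linarith
  qed
  have "AE t in lebesgue. t \<noteq> (0::real)" by (rule AE_completion[OF AE_lborel_singleton])
  then have B_deriv: "AE t in lebesgue. 0 \<le> t \<longrightarrow> (B has_real_derivative b t) (at t)"
    using AE_indefinite_integral_derivative_from[of b 0, OF b_int(1)[OF order_refl]]
    unfolding B_def[abs_def] by eventually_elim auto
  \<comment> \<open>The strict inequality leaves room for a number \<open>T'\<close> that eventually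
    bounds the quotient wherever its denominator is nonzero.\<close>
  obtain T' where T': "Limsup (inf at_top (principal {t. (\<Sum>i=1..m. a i t) \<noteq> 0}))
         (\<lambda>t. ereal (\<Sum>k=1..m. a k t / (\<Sum>i=1..m. a i t) *
                 (LINT s:{h k t..t}|lebesgue. (\<Sum>i=1..m. a i s)))) < ereal T'"
    "T' < 1 + 1 / exp 1"
    using ereal_dense2[OF limsup_quotient] by auto
  have "eventually (\<lambda>t. b t \<noteq> 0 \<longrightarrow> (\<Sum>k=1..m. a k t / b t * (LINT s:{h k t..t}|lebesgue. b s)) < T') at_top"
    using Limsup_lessD[OF T'(1)] unfolding eventually_inf_principal b_def by simp
  then obtain N1 where N1: "\<And>t. N1 \<le> t \<Longrightarrow> b t \<noteq> 0 \<Longrightarrow>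
      (\<Sum>k=1..m. a k t / b t * (LINT s:{h k t..t}|lebesgue. b s)) < T'"
    unfolding eventually_at_top_linorder by blast
  have "\<exists>r. eventually (\<lambda>t. (LINT s:{h k t..t}|lebesgue. b s) < r) at_top" if "k \<in> {1..m}" for k
    using limsup_integral[OF that] unfolding b_def by (rule Limsup_finite_imp_eventually_bound)
  then obtain Dk where Dk: "\<And>k. k \<in> {1..m} \<Longrightarrow> eventually (\<lambda>t. (LINT s:{h k t..t}|lebesgue. b s) < Dk k) at_top"
    by metis
  \<comment> \<open>The summand \<open>1\<close> makes \<open>D\<close> positive whatever the
    eventual bounds \<open>Dk\<close> are.\<close>
  define D where "D = 1 + (\<Sum>k=1..m. \<bar>Dk k\<bar>)"
  have D: "0 < D" unfolding D_def by (intro add_pos_nonneg sum_nonneg) auto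
  have DkD: "Dk k \<le> D" if "k \<in> {1..m}" for k
    using member_le_sum[of k "{1..m}" "\<lambda>k. \<bar>Dk k\<bar>"] that by (simp add: D_def)
  have "eventually (\<lambda>t. \<forall>k\<in>{1..m}. 0 \<le> h k t \<and> (LINT s:{h k t..t}|lebesgue. b s) < Dk k) at_top"
  proof (rule eventually_ball_finite)
    show "\<forall>k\<in>{1..m}. eventually (\<lambda>t. 0 \<le> h k t \<and> (LINT s:{h k t..t}|lebesgue. b s) < Dk k) at_top"
    proof
      fix k assume k: "k \<in> {1..m}"
      have "eventually (\<lambda>t. 0 \<le> h k t) at_top"
        using h_lim[OF k] unfolding filterlim_at_top by blast
      then show "eventually (\<lambda>t. 0 \<le> h k t \<and> (LINT s:{h k t..t}|lebesgue. b s) < Dk k) at_top"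
        using Dk[OF k] by (rule eventually_conj)
    qed
  qed simp
  then obtain N2 where N2: "\<And>t k. N2 \<le> t \<Longrightarrow> k \<in> {1..m} \<Longrightarrow>
      0 \<le> h k t \<and> (LINT s:{h k t..t}|lebesgue. b s) < Dk k"
    unfolding eventually_at_top_linorder by blast
  \<comment> \<open>From \<open>ts\<close> on the delayed arguments are nonnegative, so that the
    integrals over the delays are differences of \<open>B\<close>.\<close>
  define ts where "ts = max 0 (max N1 N2)"
  have ts: "0 \<le> ts" "N1 \<le> ts" "N2 \<le> ts" by (auto simp: ts_def)
  have delay: "0 \<le> h k t \<and> (LINT s:{h k t..t}|lebesgue. b s) = B t - B (h k t) \<and> B t - B (h k t) \<le> D"
    if "k \<in> {1..m}" "ts \<le> t" for k t
    using N2[of t k] LB[of "h k t" t] h_le[of k t] DkD[of k] that ts by auto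
  have mean: "AE t in lebesgue. ts \<le> t \<longrightarrow> (\<Sum>k=1..m. a k t * (B t - B (h k t))) \<le> T' * b t"
    using a0
  proof (eventually_elim, intro impI)
    fix t assume "0 \<le> t \<longrightarrow> (\<forall>k\<in>{1..m}. 0 \<le> a k t)" and t: "ts \<le> t"
    then have a: "\<forall>k\<in>{1..m}. 0 \<le> a k t" using ts by auto
    show "(\<Sum>k=1..m. a k t * (B t - B (h k t))) \<le> T' * b t"
    \<comment> \<open>Where the denominator vanishes, nonnegativity makes all coefficients zero and
      both sides vanish.\<close>
    proof (cases "b t = 0")
      case True
      then have "\<forall>k\<in>{1..m}. a k t = 0" using a unfolding b_def by (subst (asm) sum_nonneg_eq_0_iff) auto
      then have "(\<Sum>k=1..m. a k t * (B t - B (h k t))) = 0" by (intro sum.neutral) auto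
      with True show ?thesis by simp
    next
      case False
      have pos: "0 < b t" using False a sum_nonneg[of "{1..m}" "\<lambda>k. a k t"] unfolding b_def by force
      have "(\<Sum>k=1..m. a k t * (B t - B (h k t)))
          = b t * (\<Sum>k=1..m. a k t / b t * (LINT s:{h k t..t}|lebesgue. b s))"
        unfolding sum_distrib_left using pos delay[OF _ t] by (intro sum.cong) auto
      also have "\<dots> \<le> b t * T'" using N1[of t] False t ts pos by (intro mult_left_mono) auto
      finally show ?thesis by (simp add: mult.commute)
    qed
  qed
  interpret delay_equation m a h B C D T' ts
  proof
    show "AE t in lebesgue. 0 \<le> t \<longrightarrow>
      (B has_real_derivative (\<Sum>k=1..m. a k t)) (at t) \<and> (\<forall>k\<in>{1..m}. 0 \<le> a k t)"
      using B_deriv a0 unfolding b_def by eventually_elim auto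
    show "T' < 13679/10000" using T'(2) one_plus_inverse_exp_1_less by linarith
    show "AE t in lebesgue. ts \<le> t \<longrightarrow>
      (\<Sum>k=1..m. a k t * (B t - B (h k t))) \<le> T' * (\<Sum>k=1..m. a k t)"
      using mean unfolding b_def .
    show "\<exists>t\<ge>0. c \<le> B t" for c
      unfolding B_def using unbounded_integral[OF b_meas b0 b_set[OF order_refl]] integral_infinite
      unfolding b_def by blast
  qed (use h_le B_mono B_lip ts D delay in auto)
  have linear: "\<exists>\<beta>>0. \<exists>\<gamma>. \<forall>s t. 0 \<le> s \<longrightarrow> s \<le> t \<longrightarrow> \<beta> * (t - s) - \<gamma> \<le> B t - B s"
    if R: "0 < R" "0 < Liminf at_top (\<lambda>t. ereal (LINT s:{t..t+R}|lebesgue. (\<Sum>k=1..m. a k s)))" for R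
  proof -
    obtain \<kappa> where \<kappa>: "0 < ereal \<kappa>"
      "ereal \<kappa> < Liminf at_top (\<lambda>t. ereal (LINT s:{t..t+R}|lebesgue. (\<Sum>k=1..m. a k s)))"
      using ereal_dense2[OF R(2)] by blast
    have "eventually (\<lambda>t. \<kappa> < (LINT s:{t..t+R}|lebesgue. b s)) at_top"
      using less_LiminfD[OF \<kappa>(2)] unfolding b_def by simp
    then obtain N where N: "\<And>t. N \<le> t \<Longrightarrow> \<kappa> < (LINT s:{t..t+R}|lebesgue. b s)"
      unfolding eventually_at_top_linorder by blast
    have "\<kappa> \<le> B (t + R) - B t" if "max 0 N \<le> t" for t
      using N[of t] LB[of t "t + R"] that R by auto
    then have "\<kappa> / R * (t - s) - \<kappa> * (max 0 N / R + 1) \<le> B t - B s" if "0 \<le> s" "s \<le> t" for s t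
      using \<kappa>(1) R that by (intro linear_growth_from_increments[of B R \<kappa> "max 0 N"] B_mono) auto
    moreover have "0 < \<kappa> / R" using \<kappa> R by simp
    ultimately show ?thesis by blast
  qed
  have sol: "\<exists>x. is_solution m a h s (\<lambda>_. 0) 1 x" if "0 \<le> s" for s
    using a_meas h_meas h_le aC that by (rule fundamental_solution_exists)
  show ?thesis
    using asymptotically_stable linear exponentially_stable exponential_estimation[OF _ _ sol] by meson
qed

end
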